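(* Let $p$ be a prime, $t\in\mathbb{N}$, and $b_1(X),\ldots,b_t(X)\in\mathbb{F}_p[X]$ monic, nonconstant, pairwise coprime polynomials; let $(\boldsymbol{y}_n)_{n\ge0}$ be the Halton sequence in bases $b_1(X),\ldots,b_t(X)$. Let $L\in\mathbb{F}_p((X^{-1}))$ be irrational (i.e. not in $\mathbb{F}_p(X)$) such that the degrees of the partial quotients $A_i$, $i\ge1$, in its continued fraction expansion are bounded, and let $(x_n)_{n\ge0}$ be the one-dimensional digital Kronecker sequence associated with $L$. Then there is a constant $c>0$ depending only on $p,L,b_1,\ldots,b_t,t$ such that the discrepancy of the first $N$ points of $((x_n,\boldsymbol{y}_n))_{n\ge0}$ satisfies $ND_N\le c\,N^{1/2}\log^{t+1}N$ for all $N\ge2$.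
   Context: Elements of $\mathbb{F}_p$ are identified with $\{0,\ldots,p-1\}$. For $n=n_0+n_1p+\cdots+n_rp^r$ in base $p$, $n(X)=n_0+n_1X+\cdots+n_rX^r$. For $L=\sum_{i=w}^\infty a_iX^{-i}$, $\{L\}=\sum_{i\ge\max(1,w)}a_iX^{-i}$. The digital Kronecker sequence associated with $L$: writing $\{n(X)L\}=\sum_{i\ge1}c_iX^{-i}$, $x_n=\sum_{i\ge1}c_ip^{-i}$. Van der Corput sequence in base $b(X)$ (monic, nonconstant, degree $e$): write $n(X)=\sum_{i\ge0}a_i(X)b(X)^i$ with $\deg a_i<e$, $y_n=\sum_{i\ge0}a_i(p)p^{-e(i+1)}$; the Halton sequence in bases $b_1,\ldots,b_t$ juxtaposes these coordinatewise. Every irrational $L\in\mathbb{F}_p((X^{-1}))$ has a unique infinite continued fraction expansion $L=[A_0;A_1,A_2,\ldots]$ with $A_i\in\mathbb{F}_p[X]$, $\deg A_i\ge1$ for $i\ge1$. Discrepancy: $D_N=\sup_B|A_N(B)/N-\lambda(B)|$ over axis-parallel boxes $B\subseteq[0,1)^{1+t}$, $A_N(B)=\#\{0\le n<N:(x_n,\boldsymbol y_n)\in B\}$, $\lambda$ Lebesgue measure. *)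

theory Defs
  imports "HOL-Analysis.Analysis" "HOL-Computational_Algebra.Formal_Laurent_Series"
          "Berlekamp_Zassenhaus.Finite_Field"
begin

text \<open>Conventions. \<open>F_p\<close> is the type \<open>'p mod_ring\<close> with \<open>CARD('p)\<close> prime
  (class \<open>prime_card\<close>); its elements are identified with \<open>{0..p-1}\<close> via
  \<open>to_int_mod_ring\<close>.  A Laurent series \<open>L = \<Sum>_{i\<ge>w} a_i X^{-i}\<close> in \<open>F_p((X^{-1}))\<close>
  is represented as a formal Laurent series \<open>'p mod_ring fls\<close> in the variable
  \<open>Y = X^{-1}\<close>: \<open>fls_nth L i = a_i\<close> is the coefficient of \<open>X^{-i}\<close>, and \<open>X = fls_X_inv\<close>.\<close>


definition digit_poly :: "nat \<Rightarrow> 'p::prime_card mod_ring poly" where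
  "digit_poly n = (\<Sum>j\<le>n. Polynomial.monom (of_nat ((n div CARD('p) ^ j) mod CARD('p))) j)"

definition poly_to_fls :: "'a::comm_ring_1 poly \<Rightarrow> 'a fls" where
  "poly_to_fls q = (\<Sum>j\<le>degree q. fls_const (Polynomial.coeff q j) * fls_X_inv ^ j)"

definition poly_part :: "'a::comm_ring_1 fls \<Rightarrow> 'a poly" where
  "poly_part F = (\<Sum>j\<le>nat (- fls_subdegree F). Polynomial.monom (fls_nth F (- int j)) j)"

definition irrational_fls :: "'a::field fls \<Rightarrow> bool" where
  "irrational_fls L \<longleftrightarrow> \<not> (\<exists>P Q. Q \<noteq> 0 \<and> poly_to_fls Q * L = poly_to_fls P)"

fun cf_rem :: "'a::field fls \<Rightarrow> nat \<Rightarrow> 'a fls" where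
  "cf_rem L 0 = L"
| "cf_rem L (Suc i) = inverse (cf_rem L i - poly_to_fls (poly_part (cf_rem L i)))"

definition partial_quotient :: "'a::field fls \<Rightarrow> nat \<Rightarrow> 'a poly" where
  "partial_quotient L i = poly_part (cf_rem L i)"

definition kronecker_seq :: "'p::prime_card mod_ring fls \<Rightarrow> nat \<Rightarrow> real" where
  "kronecker_seq L n =
     (\<Sum>i. real_of_int (to_int_mod_ring (fls_nth (poly_to_fls (digit_poly n) * L) (int (Suc i))))
           / real CARD('p) ^ Suc i)"

definition eval_at_p :: "'p::prime_card mod_ring poly \<Rightarrow> real" where
  "eval_at_p a = (\<Sum>j\<le>degree a. real_of_int (to_int_mod_ring (Polynomial.coeff a j)) * real CARD('p) ^ j)"

text \<open>Van der Corput sequence in base \<open>b(X)\<close>: \<open>n(X) = \<Sum>_i a_i(X) b(X)^i\<close>, with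
  \<open>a_i = (n(X) div b^i) mod b\<close>; the digits \<open>a_i\<close> vanish for \<open>i > n\<close>.\<close>
definition vdc_seq :: "'p::prime_card mod_ring poly \<Rightarrow> nat \<Rightarrow> real" where
  "vdc_seq b n =
     (\<Sum>i\<le>n. eval_at_p ((digit_poly n div b ^ i) mod b) / real CARD('p) ^ (degree b * (i + 1)))"

definition kron_halton :: "'p::prime_card mod_ring fls \<Rightarrow> (nat \<Rightarrow> 'p mod_ring poly) \<Rightarrow> nat \<Rightarrow> nat \<Rightarrow> real" where
  "kron_halton L b n j = (if j = 0 then kronecker_seq L n else vdc_seq (b (j - 1)) n)"

definition discrepancy :: "nat \<Rightarrow> (nat \<Rightarrow> nat \<Rightarrow> real) \<Rightarrow> nat \<Rightarrow> real" where
  "discrepancy d P N =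
     Sup ((\<lambda>(u, v). \<bar>real (card {n. n < N \<and> (\<forall>j<d. u j \<le> P n j \<and> P n j < v j)}) / real N
                      - (\<Prod>j<d. v j - u j)\<bar>)
          ` {(u, v). \<forall>j<d. 0 \<le> u j \<and> u j \<le> v j \<and> v j \<le> 1})"

end

(* Writing the interval of each Halton coordinate as O(log N) elementary intervals, the Chinese
   remainder theorem reduces the problem to counting n < N with n(X) congruent to R modulo a product
   B of powers of the b_j and with x_n in a given interval. Let D = deg B. On a block of p^i
   consecutive n, such n correspond to the polynomials G + B h with deg h < i - D, so that x_n is
   read off from h (B L). As the partial quotients of L are bounded, Q L has a nonzero digit among
   its first deg Q + K fractional digits, for every nonzero Q. The matrix sending h to the first s
   fractional digits of h (B L) is a Hankel matrix, hence it has full rank as soon as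
   s <= i - 2D - K, and the block is equidistributed up to an error O(p^D). Summing over O(log N)
   blocks gives an error O(p^D log N), while trivially the error is O(N / p^D + log N); one of the
   two is O(sqrt N log N). The decomposition of the box contributes the remaining factor
   (log N)^t. *)

theory Submission
  imports Defs
begin

section \<open>Laurent series and bounded partial quotients\<close>

text \<open>The obstacle is the modulus \<open>B\<close>. The series \<open>B L\<close> is again
  badly approximable, but only with \<open>K\<close> replaced by \<open>degree B + K\<close>,
  because testing \<open>B L\<close> with \<open>Q\<close> means testing \<open>L\<close> with
  \<open>B * Q\<close>. Since the residue class has already consumed \<open>degree B\<close> of the
  \<open>i\<close> free coefficients of a block, \<open>2 * degree B + K\<close> digits stay out of
  reach in total. A block is thus controlled up to a multiple of \<open>p^(degree B + K)\<close>
  points, which is useful as long as \<open>p^(degree B)\<close> is at most sqrt N; this is where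
  the exponent 1/2 comes from. A second difficulty is the passage from reals to digits. The digit
  lemmas allow expansions ending in maximal digits, so a point \<open>y\<close> with leading digits
  \<open>V\<close> is only known to satisfy \<open>V <= y * q^k <= V + 1\<close>. Intervals are
  therefore enclosed between an inner and an outer union of grid cells. On the Halton axes the grid
  has at least \<open>N\<close> cells, so this rounding costs only O(t) points.\<close>

lemma fls_nth_fls_X_inv_power [simp]:
  "fls_nth (fls_X_inv ^ n :: 'a::comm_ring_1 fls) i = (if i = - int n then 1 else 0)"
  by (simp add: fls_X_inv_power_conv_shift_1)

lemma fls_nth_poly_to_fls:
  "fls_nth (poly_to_fls q) i = (if i \<le> 0 then Polynomial.coeff q (nat (- i)) else 0)"
proof -
  have "fls_nth (poly_to_fls q) i =
      (\<Sum>j\<le>degree q. if j = nat (- i) \<and> i \<le> 0 then Polynomial.coeff q j else 0)"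
    unfolding poly_to_fls_def fls_nth_sum
    by (intro sum.cong refl) auto
  also have "\<dots> = (if i \<le> 0 then Polynomial.coeff q (nat (- i)) else 0)"
    by (auto simp: sum.delta if_distrib not_le coeff_eq_0)
  finally show ?thesis .
qed

lemma poly_to_fls_0 [simp]: "poly_to_fls 0 = 0"
  by (rule fls_eqI) (simp add: fls_nth_poly_to_fls)

lemma poly_to_fls_add: "poly_to_fls (p + q) = poly_to_fls p + poly_to_fls q"
  by (rule fls_eqI) (simp add: fls_nth_poly_to_fls)

lemma poly_to_fls_diff: "poly_to_fls (p - q) = poly_to_fls p - poly_to_fls q"
  by (rule fls_eqI) (simp add: fls_nth_poly_to_fls)

lemma poly_to_fls_smult: "poly_to_fls (Polynomial.smult c p) = fls_const c * poly_to_fls p"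
  by (rule fls_eqI) (simp add: fls_nth_poly_to_fls)

lemma poly_to_fls_pCons: "poly_to_fls (pCons a q) = fls_const a + fls_X_inv * poly_to_fls q"
proof (rule fls_eqI)
  fix i :: int
  show "fls_nth (poly_to_fls (pCons a q)) i = fls_nth (fls_const a + fls_X_inv * poly_to_fls q) i"
  proof (cases "nat (- i)")
    case (Suc m)
    then have "nat (- (i + 1)) = m" "i < 0" by linarith+
    then show ?thesis
      using Suc by (simp add: fls_nth_poly_to_fls fls_X_inv_times_conv_shift)
  qed (auto simp: fls_nth_poly_to_fls fls_X_inv_times_conv_shift)
qed

lemma poly_to_fls_mult: "poly_to_fls (p * q) = poly_to_fls p * poly_to_fls q"
  by (induction p) (simp_all add: poly_to_fls_add poly_to_fls_smult poly_to_fls_pCons algebra_simps)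

lemma poly_to_fls_eq_0_iff [simp]: "poly_to_fls p = 0 \<longleftrightarrow> p = 0"
proof
  assume "poly_to_fls p = 0"
  then have "fls_nth (poly_to_fls p) (- int n) = 0" for n
    by simp
  then show "p = 0"
    by (intro poly_eqI) (simp add: fls_nth_poly_to_fls)
qed simp

lemma fls_subdegree_poly_to_fls: "fls_subdegree (poly_to_fls p) = - int (degree p)"
proof (cases "p = 0")
  case False
  then show ?thesis
    by (intro fls_subdegree_eqI) (auto simp: fls_nth_poly_to_fls coeff_eq_0)
qed simp

lemma coeff_poly_part: "Polynomial.coeff (poly_part F) j = fls_nth F (- int j)"
  by (auto simp: poly_part_def coeff_sum sum.delta)

lemma fls_nth_diff_poly_part:
  "fls_nth (F - poly_to_fls (poly_part F)) i = (if i \<le> 0 then 0 else fls_nth F i)"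
  by (auto simp: fls_nth_poly_to_fls coeff_poly_part)

lemma degree_poly_part:
  assumes "fls_subdegree F \<le> 0"
  shows "int (degree (poly_part F)) = - fls_subdegree F"
proof (cases "F = 0")
  case False
  have "degree (poly_part F) = nat (- fls_subdegree F)"
    using assms False
    by (intro antisym degree_le le_degree) (auto simp: coeff_poly_part)
  with assms show ?thesis by simp
qed (simp add: poly_part_def)

section \<open>Complete quotients of an irrational series and the quality of rational
  approximation\<close>

lemma irrational_flsD: "irrational_fls L \<Longrightarrow> Q \<noteq> 0 \<Longrightarrow> poly_to_fls Q * L - poly_to_fls P \<noteq> 0"
  unfolding irrational_fls_def by auto

lemma irrational_fls_minus_poly: "irrational_fls L \<Longrightarrow> L - poly_to_fls P \<noteq> 0"
  using irrational_flsD[of L 1 P] by (simp add: poly_to_fls_def)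

text \<open>Guarantees that the continued fraction recursion never inverts zero. If
  \<open>Q / (M - A)\<close> were a polynomial \<open>P\<close>, then \<open>P * M\<close> would be
  the polynomial \<open>P * A + Q\<close>, and \<open>P\<close> is nonzero because \<open>Q\<close>
  is.\<close>

lemma irrational_cf_rem:
  fixes L :: "'a::field fls"
  assumes "irrational_fls L"
  shows "irrational_fls (cf_rem L i)"
proof (induction i)
  case (Suc i)
  define M where "M = cf_rem L i"
  define A where "A = poly_part M"
  have M: "irrational_fls M" using Suc by (simp add: M_def)
  have nz: "M - poly_to_fls A \<noteq> 0"
    using M by (rule irrational_fls_minus_poly)
  show ?case
    unfolding irrational_fls_def
  proof (safe)
    fix P Q :: "'a poly"
    assume Q: "Q \<noteq> 0" and "poly_to_fls Q * cf_rem L (Suc i) = poly_to_fls P"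
    then have eq: "poly_to_fls Q * inverse (M - poly_to_fls A) = poly_to_fls P"
      by (simp add: M_def A_def)
    then have "poly_to_fls Q = poly_to_fls P * (M - poly_to_fls A)"
      using nz by (metis mult.assoc mult.right_neutral left_inverse)
    then have "poly_to_fls P * M - poly_to_fls (P * A + Q) = 0"
      by (simp add: poly_to_fls_add poly_to_fls_mult algebra_simps)
    moreover have "P \<noteq> 0"
      using eq Q nz by auto
    ultimately show False
      using irrational_flsD[OF M] by blast
  qed
qed (simp add: assms)

text \<open>Removing the polynomial part leaves positive order in \<open>X^-1\<close>. Inversion
  makes the order negative, so the leading term falls into the next polynomial part and determines
  its degree.\<close>

lemma fls_subdegree_cf_rem_Suc:
  fixes L :: "'a::field fls"
  assumes "irrational_fls L"
  shows "fls_subdegree (cf_rem L (Suc i)) = - int (degree (partial_quotient L (Suc i)))"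
    and "degree (partial_quotient L (Suc i)) \<ge> 1"
proof -
  let ?M = "cf_rem L i"
  let ?R = "?M - poly_to_fls (poly_part ?M)"
  have "?R \<noteq> 0"
    using irrational_cf_rem[OF assms] by (rule irrational_fls_minus_poly)
  then have "fls_subdegree ?R > 0"
    by (rule fls_subdegree_greaterI) (simp only: fls_nth_diff_poly_part split: if_splits, simp)
  then have *: "fls_subdegree (cf_rem L (Suc i)) < 0"
    by simp
  then show "fls_subdegree (cf_rem L (Suc i)) = - int (degree (partial_quotient L (Suc i)))"
    unfolding partial_quotient_def by (subst degree_poly_part) auto
  with * show "degree (partial_quotient L (Suc i)) \<ge> 1"
    by linarith
qed

text \<open>The induction replaces a denominator for one complete quotient by a denominator of smaller
  degree for the next one, as in the Euclidean algorithm.\<close>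

lemma cf_rem_badly_approximable:
  fixes L :: "'a::field fls"
  assumes irr: "irrational_fls L" and K: "\<And>i. i \<ge> 1 \<Longrightarrow> degree (partial_quotient L i) \<le> K"
  assumes "Q \<noteq> 0"
  shows "fls_subdegree (poly_to_fls Q * cf_rem L i - poly_to_fls P) \<le> int (degree Q + K)"
  using assms(3)
proof (induction "degree Q" arbitrary: Q P i rule: less_induct)
  case less
  define M where "M = cf_rem L i"
  define N where "N = cf_rem L (Suc i)"
  define A where "A = poly_part M"
  define a where "a = degree (partial_quotient L (Suc i))"
  \<comment> \<open>With \<open>M - A = 1 / N\<close>, the error \<open>Q * M - P\<close> equals
    \<open>-(P' * N - Q) / N\<close>: \<open>P'\<close> becomes the denominator and \<open>Q\<close>
    the numerator for the next complete quotient.\<close>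
  define P' where "P' = P - Q * A"
  have a: "fls_subdegree N = - int a" "a \<ge> 1" "a \<le> K"
    unfolding N_def a_def using fls_subdegree_cf_rem_Suc[OF irr] K[of "Suc i"] by auto
  have nz: "M - poly_to_fls A \<noteq> 0"
    unfolding M_def using irrational_cf_rem[OF irr] by (rule irrational_fls_minus_poly)
  have N: "N = inverse (M - poly_to_fls A)" "N \<noteq> 0"
    using nz by (simp_all add: N_def M_def A_def)
  let ?E = "poly_to_fls P' * N - poly_to_fls Q"
  have "poly_to_fls Q * M - poly_to_fls P = poly_to_fls Q * (M - poly_to_fls A) - poly_to_fls P'"
    by (simp add: P'_def poly_to_fls_diff poly_to_fls_mult algebra_simps)
  also have "\<dots> = - ?E * inverse N"
  proof -
    have "inverse N = M - poly_to_fls A" "N * (M - poly_to_fls A) = 1"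
      using nz by (simp_all add: N(1) del: right_minus_eq)
    then show ?thesis
      by (metis (no_types, lifting) left_diff_distrib minus_diff_eq mult.assoc mult.right_neutral)
  qed
  finally have eq: "poly_to_fls Q * M - poly_to_fls P = - ?E * inverse N" .
  have Enz: "?E \<noteq> 0"
  proof (cases "P' = 0")
    case False
    then show ?thesis
      unfolding N_def using irrational_flsD[OF irrational_cf_rem[OF irr]] by blast
  qed (use less.prems in simp)
  have ord: "fls_subdegree (poly_to_fls Q * M - poly_to_fls P) = fls_subdegree ?E + int a"
    unfolding eq mult_minus_left fls_uminus_subdegree using Enz N(2) a(1)
    by (subst fls_subdegree_mult) simp_all
  \<comment> \<open>Only the last case recurses: \<open>a >= 1\<close> forces
    \<open>degree P' < degree Q\<close>, and the extra \<open>a\<close> is absorbed by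
    \<open>degree P' + a <= degree Q\<close>. In the middle case \<open>P' * N\<close> dominates
    \<open>Q\<close>, so nothing cancels.\<close>
  consider "P' = 0" | "P' \<noteq> 0" "degree P' + a > degree Q" | "P' \<noteq> 0" "degree P' + a \<le> degree Q"
    by linarith
  then show ?case
  proof cases
    case 1
    then show ?thesis
      using ord a by (simp add: fls_subdegree_poly_to_fls M_def)
  next
    case 2
    have s: "fls_subdegree (poly_to_fls P' * N) = - int (degree P') - int a"
      using 2 N(2) a(1) by (simp add: fls_subdegree_poly_to_fls)
    have "fls_subdegree ?E = fls_subdegree (poly_to_fls P' * N)"
      using 2 N(2) by (intro fls_subdegree_diff_eq1) (auto simp: s fls_subdegree_poly_to_fls)
    then show ?thesis
      using ord s by (simp add: M_def)
  next
    case 3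
    then have "fls_subdegree ?E \<le> int (degree P' + K)"
      unfolding N_def using a by (intro less.hyps) auto
    then show ?thesis
      using ord 3 by (simp add: M_def)
  qed
qed

text \<open>Case \<open>i = 0\<close> with \<open>P\<close> the polynomial part: the remainder has
  order between 1 and \<open>degree Q + K\<close>, and its leading coefficient is the digit
  sought.\<close>

lemma badly_approximable:
  fixes L :: "'a::field fls"
  assumes "irrational_fls L" "\<And>i. i \<ge> 1 \<Longrightarrow> degree (partial_quotient L i) \<le> K" "Q \<noteq> 0"
  shows "\<exists>l < degree Q + K. fls_nth (poly_to_fls Q * L) (int (Suc l)) \<noteq> 0"
proof -
  let ?F = "poly_to_fls Q * L"
  let ?R = "?F - poly_to_fls (poly_part ?F)"
  let ?s = "fls_subdegree ?R"
  have "?R \<noteq> 0"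
    using assms(1,3) by (rule irrational_flsD)
  then have "fls_nth ?R ?s \<noteq> 0"
    by (rule nth_fls_subdegree_nonzero)
  then have s: "?s > 0" "fls_nth ?F ?s \<noteq> 0"
    unfolding fls_nth_diff_poly_part by (auto split: if_splits)
  have le: "?s \<le> int (degree Q + K)"
    using cf_rem_badly_approximable[OF assms, of 0 "poly_part ?F"] by simp
  define l where "l = nat ?s - 1"
  have l: "int (Suc l) = ?s"
    using s by (simp add: l_def)
  have "fls_nth ?F (int (Suc l)) \<noteq> 0"
    unfolding l by (rule s(2))
  moreover have "l < degree Q + K"
    using l le by linarith
  ultimately show ?thesis by blast
qed

section \<open>Equidistribution of the leading digits\<close>

text \<open>Phrased through coefficients so that the zero polynomial belongs even for
  \<open>m = 0\<close>; this is the vector space of dimension \<open>m\<close>.\<close>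

definition polys_below :: "nat \<Rightarrow> 'a::zero poly set" where
  "polys_below m = {h. \<forall>j\<ge>m. Polynomial.coeff h j = 0}"

lemma polys_below_0 [simp]: "polys_below 0 = {0}"
  by (auto simp: polys_below_def poly_eq_iff)

lemma polys_below_iff: "h \<in> polys_below m \<longleftrightarrow> h = 0 \<or> degree h < m"
proof
  assume h: "h \<in> polys_below m"
  show "h = 0 \<or> degree h < m"
  proof (rule ccontr)
    assume "\<not> ?thesis"
    then have "Polynomial.coeff h (degree h) = 0" "h \<noteq> 0"
      using h by (auto simp: polys_below_def)
    then show False by simp
  qed
qed (auto simp: polys_below_def coeff_eq_0)

lemma polys_below_Suc: "polys_below (Suc m) = (\<lambda>(a, h). pCons a h) ` (UNIV \<times> polys_below m)"
proof (intro equalityI subsetI)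
  fix h :: "'a poly" assume "h \<in> polys_below (Suc m)"
  moreover obtain a g where "h = pCons a g" by (rule pCons_cases)
  ultimately show "h \<in> (\<lambda>(a, h). pCons a h) ` (UNIV \<times> polys_below m)"
    by (force simp: polys_below_def coeff_pCons split: nat.splits)
qed (auto simp: polys_below_def coeff_pCons split: nat.splits)

lemma finite_polys_below [simp]: "finite (polys_below m :: 'a::{zero,finite} poly set)"
  by (induction m) (simp_all add: polys_below_Suc)

lemma card_polys_below: "card (polys_below m :: 'a::{zero,finite} poly set) = CARD('a) ^ m"
proof (induction m)
  case (Suc m)
  have "inj_on (\<lambda>(a, h). pCons a h) (UNIV \<times> polys_below m :: ('a \<times> 'a poly) set)"
    by (auto simp: inj_on_def)
  then show ?case
    by (simp add: polys_below_Suc card_image card_cartesian_product Suc)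
qed simp

lemma polys_below_closed:
  fixes g h :: "'a::comm_ring_1 poly"
  shows "g \<in> polys_below m \<Longrightarrow> h \<in> polys_below m \<Longrightarrow> g + h \<in> polys_below m"
    and "g \<in> polys_below m \<Longrightarrow> h \<in> polys_below m \<Longrightarrow> g - h \<in> polys_below m"
    and "g \<in> polys_below m \<Longrightarrow> Polynomial.smult a g \<in> polys_below m"
    and "(\<And>x. x \<in> A \<Longrightarrow> f x \<in> polys_below m) \<Longrightarrow> sum f A \<in> (polys_below m :: 'a poly set)"
  by (auto simp: polys_below_def coeff_sum)

text \<open>Digits count from 0, so digit \<open>j\<close> sits at \<open>X^-(j+1)\<close>. Only
  negative powers of \<open>X\<close> are read: this is a digit of the fractional part, and it is
  linear in \<open>h\<close>.\<close>

definition frac_coeff :: "'a::comm_ring_1 fls \<Rightarrow> 'a poly \<Rightarrow> nat \<Rightarrow> 'a" where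
  "frac_coeff M h j = fls_nth (poly_to_fls h * M) (int (Suc j))"

lemma frac_coeff_add: "frac_coeff M (g + h) j = frac_coeff M g j + frac_coeff M h j"
  by (simp add: frac_coeff_def poly_to_fls_add algebra_simps)

lemma frac_coeff_diff: "frac_coeff M (g - h) j = frac_coeff M g j - frac_coeff M h j"
  by (simp add: frac_coeff_def poly_to_fls_diff algebra_simps)

lemma frac_coeff_smult: "frac_coeff M (Polynomial.smult a h) j = a * frac_coeff M h j"
  by (simp add: frac_coeff_def poly_to_fls_smult mult.assoc)

lemma frac_coeff_sum: "frac_coeff M (sum f A) j = (\<Sum>x\<in>A. frac_coeff M (f x) j)"
proof (induction A rule: infinite_finite_induct)
qed (simp_all add: frac_coeff_add, simp_all add: frac_coeff_def)

text \<open>The Hankel property: the entry depends on \<open>i + j\<close> only, so coefficient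
  index and digit index can be interchanged.\<close>

lemma frac_coeff_monom: "frac_coeff M (Polynomial.monom a i) j = a * fls_nth M (int (Suc (i + j)))"
proof -
  have "poly_to_fls (Polynomial.monom a i) = fls_const a * fls_X_inv ^ i"
    by (rule fls_eqI) (auto simp: fls_nth_poly_to_fls)
  then show ?thesis
    by (simp add: frac_coeff_def fls_X_inv_power_conv_shift_1 fls_shifted_times_simps add_ac)
qed

text \<open>The matrix of the map sending \<open>h\<close> to its first \<open>s\<close> digits is a Hankel matrix, so a linear
  dependency between its rows is again a polynomial \<open>Q\<close>, now of degree below \<open>s\<close>.\<close>

lemma card_frac_coeff_fiber:
  fixes M :: "'a::{field,finite} fls"
  assumes "\<And>Q. Q \<noteq> 0 \<Longrightarrow> degree Q < s \<Longrightarrow> \<exists>l<m. frac_coeff M Q l \<noteq> 0"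
  shows "card {h \<in> polys_below m. \<forall>j<s. frac_coeff M h j = w j} * CARD('a) ^ s = CARD('a) ^ m"
  using assms
proof (induction s arbitrary: w)
  case 0
  then show ?case by (simp add: card_polys_below)
next
  case (Suc s)
  define S where "S w = {h \<in> polys_below m. \<forall>j<s. frac_coeff M h j = w j}" for w
  have card_S: "card (S w) * CARD('a) ^ s = CARD('a) ^ m" for w
    unfolding S_def by (rule Suc.IH) (use Suc.prems in auto)
  have fin_S: "finite (S w)" for w
    by (auto simp: S_def)
  have S_ex: "\<exists>h. h \<in> S w" for w
  proof (rule ccontr)
    assume "\<not> ?thesis"
    then have "S w = {}" by auto
    then show False using card_S[of w] by simp
  qed
  \<comment> \<open>The next digit functional is independent of the first \<open>s\<close> ones: it
    does not vanish on their common kernel.\<close>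
  have "\<exists>k \<in> S (\<lambda>_. 0). frac_coeff M k s \<noteq> 0"
  proof (rule ccontr)
    assume "\<not> ?thesis"
    then have van: "frac_coeff M k s = 0" if "k \<in> S (\<lambda>_. 0)" for k
      using that by auto
    have "\<forall>i. \<exists>h. h \<in> S (\<lambda>j. if j = i then 1 else 0)"
      using S_ex by blast
    then obtain e where e: "\<And>i. e i \<in> S (\<lambda>j. if j = i then 1 else 0)"
      by metis
    define c where "c j = frac_coeff M (e j) s" for j
    \<comment> \<open>If digit \<open>s\<close> vanished on that kernel, it would be the combination
      of the digits \<open>j < s\<close> with coefficients \<open>c j\<close>, its values on the
      dual vectors \<open>e j\<close>. \<open>Q\<close> records this relation; by the Hankel
      symmetry, digit \<open>l\<close> of \<open>Q\<close> is the relation evaluated at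
      \<open>X^l\<close>.\<close>
    define Q where "Q = Polynomial.monom 1 s - (\<Sum>j<s. Polynomial.monom (c j) j)"
    have "Polynomial.coeff Q s = 1"
      by (simp add: Q_def coeff_sum)
    then have Q0: "Q \<noteq> 0" by auto
    have "degree Q \<le> s"
      unfolding Q_def
      by (intro degree_diff_le degree_sum_le order.trans[OF degree_monom_le]) auto
    then obtain l where l: "l < m" "frac_coeff M Q l \<noteq> 0"
      using Suc.prems[OF Q0] by auto
    define x where "x = (Polynomial.monom 1 l :: 'a poly)"
    \<comment> \<open>The projection of \<open>X^l\<close> along the \<open>e j\<close> onto the
      common kernel of the first \<open>s\<close> digits.\<close>
    define k where "k = x - (\<Sum>j<s. Polynomial.smult (frac_coeff M x j) (e j))"
    have "frac_coeff M k i = 0" if "i < s" for i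
    proof -
      have "(\<Sum>j<s. frac_coeff M x j * frac_coeff M (e j) i)
          = (\<Sum>j<s. if j = i then frac_coeff M x j else 0)"
        using e that by (intro sum.cong) (auto simp: S_def)
      then show ?thesis
        using that by (simp add: k_def frac_coeff_diff frac_coeff_sum frac_coeff_smult)
    qed
    moreover have "k \<in> polys_below m"
      unfolding k_def using l e
      by (intro polys_below_closed) (auto simp: S_def x_def polys_below_def)
    ultimately have "frac_coeff M k s = 0"
      by (intro van) (auto simp: S_def)
    then have "frac_coeff M x s = (\<Sum>j<s. frac_coeff M x j * c j)"
      by (simp add: k_def frac_coeff_diff frac_coeff_sum frac_coeff_smult c_def)
    then have "frac_coeff M Q l = 0"
      by (simp add: Q_def x_def frac_coeff_diff frac_coeff_sum frac_coeff_monom add.commute mult.commute)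
    with l show False by simp
  qed
  then obtain k where k: "k \<in> S (\<lambda>_. 0)" "frac_coeff M k s \<noteq> 0" by blast
  define k1 where "k1 = Polynomial.smult (inverse (frac_coeff M k s)) k"
  have k1: "k1 \<in> polys_below m" "\<And>j. j < s \<Longrightarrow> frac_coeff M k1 j = 0" "frac_coeff M k1 s = 1"
    using k by (auto simp: S_def k1_def frac_coeff_smult intro: polys_below_closed)
  \<comment> \<open>Translation by a multiple of \<open>k1\<close> changes digit \<open>s\<close>
    and preserves the earlier ones, so the fibers over the values of digit \<open>s\<close> are
    equinumerous.\<close>
  define T where "T a = {h \<in> S w. frac_coeff M h s = a}" for a
  have card_T: "card (T a) = card (T (w s))" for a
  proof (rule bij_betw_same_card)
    show "bij_betw (\<lambda>h. h + Polynomial.smult (w s - a) k1) (T a) (T (w s))"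
      by (rule bij_betwI[where g = "\<lambda>h. h - Polynomial.smult (w s - a) k1"])
        (use k1 in \<open>auto simp: T_def S_def frac_coeff_add frac_coeff_diff frac_coeff_smult
          intro!: polys_below_closed\<close>)
  qed
  have "S w = (\<Union>a\<in>UNIV. T a)"
    by (auto simp: T_def)
  then have "card (S w) = (\<Sum>a\<in>UNIV. card (T a))"
    using fin_S[of w] by (simp only:) (rule card_UN_disjoint, auto simp: T_def)
  also have "\<dots> = (\<Sum>a\<in>(UNIV :: 'a set). card (T (w s)))"
    by (intro sum.cong refl card_T)
  finally have "card (S w) = CARD('a) * card (T (w s))"
    by simp
  moreover have "{h \<in> polys_below m. \<forall>j<Suc s. frac_coeff M h j = w j} = T (w s)"
    by (auto simp: T_def S_def less_Suc_eq)
  ultimately show ?case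
    using card_S[of w] by (simp add: mult_ac)
qed

section \<open>Integers as polynomials\<close>

definition residue_nat :: "'p::prime_card mod_ring \<Rightarrow> nat" where
  "residue_nat x = nat (to_int_mod_ring x)"

lemma to_int_mod_ring_bounds: "0 \<le> to_int_mod_ring x" "to_int_mod_ring (x :: 'p::prime_card mod_ring) < int CARD('p)"
  using range_to_int_mod_ring[where 'a = 'p] by (auto simp: set_eq_iff image_iff)

lemma real_residue_nat: "real_of_int (to_int_mod_ring x) = real (residue_nat x)"
  using to_int_mod_ring_bounds[of x] by (simp add: residue_nat_def)

lemma residue_nat_less: "residue_nat (x :: 'p::prime_card mod_ring) < CARD('p)"
  using to_int_mod_ring_bounds[of x] by (simp add: residue_nat_def nat_less_iff)

lemma of_nat_residue_nat [simp]: "of_nat (residue_nat x) = x"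
  using to_int_mod_ring_bounds[of x] by (simp add: residue_nat_def of_nat_of_int_mod_ring)

lemma residue_nat_of_nat: "residue_nat (of_nat n :: 'p::prime_card mod_ring) = n mod CARD('p)"
proof -
  have "(of_nat n :: 'p mod_ring) = of_nat (n mod CARD('p))"
    using of_nat_mod_CHAR[where 'a = "'p mod_ring", of n] by simp
  then show ?thesis
    by (simp add: residue_nat_def of_nat_of_int_mod_ring del: of_nat_mod_CHAR)
qed

lemma residue_nat_0 [simp]: "residue_nat 0 = 0"
  by (simp add: residue_nat_def)

lemma residue_nat_inject: "residue_nat x = residue_nat y \<longleftrightarrow> x = y"
  by (metis of_nat_residue_nat)

lemma CARD_prime_gt_1: "CARD('p::prime_card) > 1"
  using prime_card[where 'a = 'p] prime_gt_1_nat by blast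

text \<open>Beyond the cutoff \<open>j <= n\<close> the digits vanish because
  \<open>n < p^n\<close>.\<close>

lemma coeff_digit_poly:
  "Polynomial.coeff (digit_poly n :: 'p::prime_card mod_ring poly) j
    = of_nat (n div CARD('p) ^ j mod CARD('p))"
proof (cases "j \<le> n")
  case False
  have "n < CARD('p) ^ n"
    by (rule power_gt_expt) (use CARD_prime_gt_1[where 'p = 'p] in simp)
  also have "\<dots> \<le> CARD('p) ^ j"
    using False by (intro power_increasing) auto
  finally show ?thesis
    using False by (simp add: digit_poly_def coeff_sum)
qed (simp add: digit_poly_def coeff_sum)

lemma digit_poly_0 [simp]: "digit_poly 0 = 0"
  by (simp add: digit_poly_def)

lemma digit_poly_pCons:
  "digit_poly (residue_nat x + CARD('p) * n) = pCons (x :: 'p::prime_card mod_ring) (digit_poly n)"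
proof (rule poly_eqI)
  fix j
  have "(residue_nat x + CARD('p) * n) div CARD('p) = n"
    using residue_nat_less[of x] by simp
  then show "Polynomial.coeff (digit_poly (residue_nat x + CARD('p) * n)) j =
      Polynomial.coeff (pCons x (digit_poly n)) j"
    using residue_nat_less[of x]
    by (cases j) (simp_all add: coeff_digit_poly div_mult2_eq del: of_nat_mod_CHAR)
qed

text \<open>The inverse of \<open>digit_poly\<close>, and the natural number whose real value is
  \<open>eval_at_p\<close>.\<close>

definition poly_nat :: "'p::prime_card mod_ring poly \<Rightarrow> nat" where
  "poly_nat a = (\<Sum>j\<le>degree a. residue_nat (Polynomial.coeff a j) * CARD('p) ^ j)"

lemma eval_at_p_eq_poly_nat: "eval_at_p a = real (poly_nat a)"
  by (simp add: eval_at_p_def poly_nat_def real_residue_nat)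

lemma poly_nat_0 [simp]: "poly_nat 0 = 0"
  by (simp add: poly_nat_def)

lemma poly_nat_pCons: "poly_nat (pCons x a) = residue_nat x + CARD('p) * poly_nat (a :: 'p::prime_card mod_ring poly)"
proof (cases "a = 0")
  case False
  then show ?thesis
    by (simp add: poly_nat_def sum.atMost_Suc_shift sum_distrib_left mult_ac del: sum.atMost_Suc)
qed (simp add: poly_nat_def)

lemma digit_poly_poly_nat [simp]: "digit_poly (poly_nat a) = a"
  by (induction a) (simp_all add: poly_nat_pCons digit_poly_pCons)

lemma poly_nat_digit_poly [simp]: "poly_nat (digit_poly n :: 'p::prime_card mod_ring poly) = n"
proof (induction n rule: less_induct)
  case (less n)
  show ?case
  proof (cases "n = 0")
    case False
    have n: "residue_nat (of_nat n :: 'p mod_ring) + CARD('p) * (n div CARD('p)) = n"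
      by (simp add: residue_nat_of_nat)
    have "n div CARD('p) < n"
      using False CARD_prime_gt_1[where 'p = 'p] by simp
    then have "poly_nat (digit_poly (n div CARD('p)) :: 'p mod_ring poly) = n div CARD('p)"
      by (rule less.IH)
    then have "poly_nat (pCons (of_nat n :: 'p mod_ring) (digit_poly (n div CARD('p)))) = n"
      unfolding poly_nat_pCons by (simp only: n)
    then show ?thesis
      by (simp only: digit_poly_pCons[symmetric] n)
  qed simp
qed

lemma digit_poly_eq_iff [simp]: "digit_poly m = (digit_poly n :: 'p::prime_card mod_ring poly) \<longleftrightarrow> m = n"
  by (metis poly_nat_digit_poly)

lemma poly_nat_eq_iff: "poly_nat f = poly_nat g \<longleftrightarrow> f = g"
  by (metis digit_poly_poly_nat)

text \<open>Division by \<open>p^i\<close> shifts the coefficients down by \<open>i\<close>. A block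
  of \<open>p^i\<close> consecutive integers is therefore a coset of \<open>polys_below i\<close>,
  which turns counting in blocks into linear algebra.\<close>

lemma div_power_eq_iff_digit_poly:
  "n div CARD('p) ^ i = c \<longleftrightarrow>
    digit_poly n - Polynomial.monom 1 i * digit_poly c \<in> (polys_below i :: 'p::prime_card mod_ring poly set)"
proof -
  have shift: "Polynomial.coeff (digit_poly (n div CARD('p) ^ i)) j
      = Polynomial.coeff (digit_poly n :: 'p mod_ring poly) (i + j)" for j
    by (simp add: coeff_digit_poly div_mult2_eq power_add del: of_nat_mod_CHAR)
  have "n div CARD('p) ^ i = c \<longleftrightarrow> digit_poly (n div CARD('p) ^ i) = (digit_poly c :: 'p mod_ring poly)"
    by simp
  also have "\<dots> \<longleftrightarrow> (\<forall>j. Polynomial.coeff (digit_poly n :: 'p mod_ring poly) (i + j)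
      = Polynomial.coeff (digit_poly c) j)"
    by (simp add: poly_eq_iff shift)
  also have "\<dots> \<longleftrightarrow> (\<forall>j\<ge>i. Polynomial.coeff (digit_poly n :: 'p mod_ring poly) j
      = Polynomial.coeff (digit_poly c) (j - i))"
    by (metis add_diff_cancel_left' le_add1 le_add_diff_inverse)
  also have "\<dots> \<longleftrightarrow> digit_poly n - Polynomial.monom 1 i * digit_poly c
      \<in> (polys_below i :: 'p mod_ring poly set)"
    by (auto simp: polys_below_def coeff_monom_mult)
  finally show ?thesis .
qed

lemma poly_nat_less_iff:
  "poly_nat a < CARD('p) ^ e \<longleftrightarrow> a \<in> (polys_below e :: 'p::prime_card mod_ring poly set)"
  using div_power_eq_iff_digit_poly[where 'p = 'p, of "poly_nat a" e 0]
  by (simp add: div_eq_0_iff)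

section \<open>Digit expansions and decompositions into elementary intervals\<close>

text \<open>Horner value of the first \<open>k\<close> digits with \<open>z 0\<close> most
  significant: the integer approximation to \<open>q^k\<close> times the real number with base
  \<open>q\<close> digits \<open>z\<close>.\<close>

primrec digit_value :: "nat \<Rightarrow> (nat \<Rightarrow> nat) \<Rightarrow> nat \<Rightarrow> nat" where
  "digit_value q z 0 = 0"
| "digit_value q z (Suc k) = q * digit_value q z k + z k"

lemma digit_value_Suc_eq_iff:
  assumes "\<And>j. z j < q"
  shows "digit_value q z (Suc k) = c \<longleftrightarrow> digit_value q z k = c div q \<and> z k = c mod q"
proof -
  have q: "z k < q" by (rule assms)
  show ?thesis
  proof
    assume "digit_value q z (Suc k) = c"
    then show "digit_value q z k = c div q \<and> z k = c mod q"
      using q by auto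
  qed (use q in auto)
qed

lemma digit_value_div:
  assumes "\<And>j. z j < q" "k \<le> n"
  shows "digit_value q z n div q ^ (n - k) = digit_value q z k"
  using assms(2)
proof (induction n rule: dec_induct)
  case (step n)
  have "digit_value q z (Suc n) div q = digit_value q z n"
    using assms(1)[of n] by simp
  then show ?case
    using step by (simp add: Suc_diff_le div_mult2_eq)
qed simp

text \<open>The \<open>w j\<close> are the base \<open>q\<close> digits of \<open>W\<close>. A whole
  family \<open>z\<close> is treated so that one \<open>w\<close> serves all points of a
  sequence.\<close>

lemma digit_value_eq_iff:
  assumes "\<And>i j. z i j < q" "W < q ^ s"
  shows "\<exists>w. (\<forall>j<s. w j < q) \<and> (\<forall>i. digit_value q (z i) s = W \<longleftrightarrow> (\<forall>j<s. z i j = w j))"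
  using assms(2)
proof (induction s arbitrary: W)
  case (Suc s)
  have "W div q < q ^ s"
    using Suc.prems by (simp add: less_mult_imp_div_less mult.commute)
  then obtain w where wq: "\<forall>j<s. w j < q"
    and w: "\<And>i. digit_value q (z i) s = W div q \<longleftrightarrow> (\<forall>j<s. z i j = w j)"
    using Suc.IH by blast
  have "digit_value q (z i) (Suc s) = W \<longleftrightarrow> (\<forall>j<Suc s. z i j = (if j = s then W mod q else w j))" for i
    unfolding digit_value_Suc_eq_iff[of "z i" q, OF assms(1)] w by (auto simp: less_Suc_eq)
  moreover have "W mod q < q"
    using assms(1)[of undefined 0] by simp
  ultimately show ?case
    using wq by (intro exI[of _ "\<lambda>j. if j = s then W mod q else w j"] conjI allI) (auto simp: less_Suc_eq)
qed auto

text \<open>The partial values rise to \<open>y\<close> while the right ends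
  \<open>(digit_value + 1) / q^n\<close> fall. The upper bound is not strict: a tail of digits
  \<open>q - 1\<close> attains it, so \<open>digit_value\<close> need not be a floor.\<close>

lemma digit_value_bounds:
  assumes z: "\<And>j. z j < q"
  defines "y \<equiv> (\<Sum>j. real (z j) / real q ^ Suc j)"
  shows "real (digit_value q z k) \<le> y * real q ^ k"
    and "y * real q ^ k \<le> real (digit_value q z k) + 1"
proof -
  have q: "real q > 0" using z[of 0] by simp
  have partial: "(\<Sum>j<n. real (z j) / real q ^ Suc j) = real (digit_value q z n) / real q ^ n" for n
    using q by (induction n) (simp_all add: field_simps)
  have anti: "(real (digit_value q z n) + 1) / real q ^ n \<le> (real (digit_value q z k) + 1) / real q ^ k"
    if "k \<le> n" for k n
    using that
  proof (induction n rule: dec_induct)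
    case (step n)
    have "real (z n) + 1 \<le> real q"
      using z[of n] by linarith
    then have "(real (digit_value q z (Suc n)) + 1) / real q ^ Suc n
        \<le> (real q * real (digit_value q z n) + real q) / real q ^ Suc n"
      using q by (intro divide_right_mono) auto
    also have "\<dots> = (real (digit_value q z n) + 1) / real q ^ n"
      using q by (simp add: field_simps)
    finally show ?case using step by simp
  qed simp
  have upper: "(\<Sum>j<n. real (z j) / real q ^ Suc j) \<le> (real (digit_value q z k) + 1) / real q ^ k"
    if "k \<le> n" for n k
  proof -
    have "(\<Sum>j<n. real (z j) / real q ^ Suc j) \<le> (real (digit_value q z n) + 1) / real q ^ n"
      unfolding partial by (intro divide_right_mono) auto
    then show ?thesis
      using anti[OF that] by (rule order.trans)
  qed
  have summ: "summable (\<lambda>j. real (z j) / real q ^ Suc j)"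
  proof (rule bounded_imp_summable)
    show "(\<Sum>j\<le>n. real (z j) / real q ^ Suc j) \<le> 1" for n
      using upper[of 0 "Suc n"] by (simp add: lessThan_Suc_atMost)
  qed auto
  have "real (digit_value q z k) / real q ^ k \<le> y"
    unfolding partial[symmetric] y_def using q by (intro sum_le_suminf summ) auto
  then show "real (digit_value q z k) \<le> y * real q ^ k"
    using q by (simp add: field_simps)
  have "y \<le> (real (digit_value q z k) + 1) / real q ^ k"
    unfolding y_def using summable_LIMSEQ[OF summ]
    by (rule LIMSEQ_le_const2) (use upper in blast)
  then show "y * real q ^ k \<le> real (digit_value q z k) + 1"
    using q by (simp add: field_simps)
qed

text \<open>The pair \<open>(k, c)\<close> stands for the integers from \<open>c * q^k\<close> up to
  but excluding \<open>(c + 1) * q^k\<close>. Each level trims fewer than \<open>q\<close> points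
  from either end to reach multiples of \<open>q\<close>, and the rest is divided by
  \<open>q\<close>; hence at most \<open>2 * q\<close> pieces on each of \<open>M + 1\<close>
  levels. The sum of indicators expresses covering and disjointness at once.\<close>

lemma q_adic_decomposition:
  assumes "q > 1" "a \<le> b" "b \<le> q ^ M"
  shows "\<exists>F :: (nat \<times> nat) set. finite F \<and> card F \<le> 2 * q * (M + 1) \<and> (\<forall>(k, c) \<in> F. k \<le> M) \<and>
    (\<forall>x. of_bool (a \<le> x \<and> x < b) = (\<Sum>(k, c)\<in>F. of_bool (x div q ^ k = c) :: nat)) \<and>
    (\<Sum>(k, c)\<in>F. q ^ k) = b - a"
  using assms(2,3)
proof (induction M arbitrary: a b)
  case 0
  define F where "F = (if a < b then {(0, 0)} else {} :: (nat \<times> nat) set)"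
  have "b \<le> 1" using 0 by simp
  then show ?case
    using 0 assms(1) by (intro exI[of _ F]) (auto simp: F_def)
next
  case (Suc M)
  define a' where "a' = (a + (q - 1)) div q"
  define b' where "b' = b div q"
  have sing: "of_bool (l \<le> x \<and> x < u) = (\<Sum>(k, c)\<in>Pair 0 ` {l..<u}. of_bool (x div q ^ k = c) :: nat)" for l u x
    by (subst sum.reindex) (auto simp: inj_on_def sum.delta)
  have card_sing: "card (Pair (0::nat) ` {l..<u}) = u - l" for l u :: nat
    by (subst card_image) (auto simp: inj_on_def)
  have sum_sing: "(\<Sum>(k, c)\<in>Pair 0 ` {l..<u}. q ^ k) = u - l" for l u :: nat
    by (subst sum.reindex) (auto simp: inj_on_def)
  have dm: "q * (n div q) + n mod q = n" "n mod q < q" for n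
    using assms(1) by auto
  define l u where "l = q * a'" and "u = q * b'"
  have a'1: "a \<le> l" "l < a + q"
    using dm[of "a + (q - 1)"] assms(1) unfolding l_def a'_def by linarith+
  have b'1: "u \<le> b" "b < u + q"
    using dm[of b] unfolding u_def b'_def by linarith+
  show ?case
  proof (cases "a' \<le> b'")
    case True
    have "b' \<le> q ^ M"
      using Suc.prems div_le_mono[of b "q * q ^ M" q] assms(1) by (simp add: b'_def)
    then obtain F where F: "finite F" "card F \<le> 2 * q * (M + 1)" "\<forall>(k, c) \<in> F. k \<le> M"
      "\<And>x. of_bool (a' \<le> x \<and> x < b') = (\<Sum>(k, c)\<in>F. of_bool (x div q ^ k = c) :: nat)"
      "(\<Sum>(k, c)\<in>F. q ^ k) = b' - a'"
      using Suc.IH[OF True] by blast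
    define G where "G = (\<lambda>(k, c :: nat). (Suc k, c)) ` F"
    have inj: "inj_on (\<lambda>(k, c :: nat). (Suc k, c)) F"
      by (auto simp: inj_on_def)
    define H where "H = Pair 0 ` {a..<l} \<union> Pair 0 ` {u..<b} \<union> G"
    have le: "l \<le> u" unfolding l_def u_def using True by (rule mult_le_mono2)
    have sumH: "sum f H = sum f (Pair 0 ` {a..<l}) + sum f (Pair 0 ` {u..<b}) + sum f G"
      for f :: "nat \<times> nat \<Rightarrow> nat"
      unfolding H_def using F(1) le
      by (subst sum.union_disjoint, force simp: G_def, force simp: G_def, force simp: G_def,
          subst sum.union_disjoint) auto
    have "card H = (l - a) + (b - u) + card F"
      using sumH[of "\<lambda>_. 1"] inj by (simp add: card_sing G_def card_image)
    then have "card H \<le> 2 * q * (Suc M + 1)"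
      using F(2) a'1 b'1 by simp
    moreover have "finite H" "\<forall>(k, c) \<in> H. k \<le> Suc M"
      using F by (auto simp: H_def G_def)
    moreover have "of_bool (a \<le> x \<and> x < b) = (\<Sum>(k, c)\<in>H. of_bool (x div q ^ k = c) :: nat)" for x
    proof -
      have "a' \<le> x div q \<longleftrightarrow> l \<le> x" "x div q < b' \<longleftrightarrow> x < u"
        using assms(1) unfolding l_def u_def by (simp_all add: less_eq_div_iff_mult_less_eq div_less_iff_less_mult mult.commute)
      moreover have "(\<Sum>(k, c)\<in>G. of_bool (x div q ^ k = c) :: nat)
          = (\<Sum>(k, c)\<in>F. of_bool (x div q div q ^ k = c))"
        unfolding G_def by (subst sum.reindex[OF inj]) (simp add: case_prod_unfold div_mult2_eq)
      ultimately have "(\<Sum>(k, c)\<in>G. of_bool (x div q ^ k = c) :: nat) = of_bool (l \<le> x \<and> x < u)"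
        by (simp add: F(4)[symmetric])
      then show ?thesis
        unfolding sumH sing[symmetric] using le a'1 b'1 by auto
    qed
    moreover have "(\<Sum>(k, c)\<in>H. q ^ k) = b - a"
    proof -
      have "(\<Sum>(k, c)\<in>G. q ^ k) = q * (b' - a')"
        unfolding G_def F(5)[symmetric]
        by (subst sum.reindex[OF inj]) (simp add: case_prod_unfold sum_distrib_left)
      then show ?thesis
        unfolding sumH sum_sing using le a'1 b'1 by (simp add: l_def u_def diff_mult_distrib2)
    qed
    ultimately show ?thesis by blast
  next
    case False
    \<comment> \<open>Now \<open>b < u + q <= l < a + q\<close>, so fewer than \<open>q\<close>
      points are to be covered and singletons suffice.\<close>
    then have "u + q \<le> l"
      using mult_le_mono2[of "Suc b'" a' q] unfolding l_def u_def by simp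
    then have "b - a \<le> 2 * q * (Suc M + 1)"
      using a'1 b'1 by simp
    then show ?thesis
      using sing sum_sing card_sing
      by (intro exI[of _ "Pair 0 ` {a..<b}"]) auto
  qed
qed

section \<open>Points of the Kronecker sequence in a residue class\<close>

lemma inner_grid_interval:
  fixes u v :: real
  assumes "0 \<le> u" "u \<le> v" "v \<le> 1"
  shows "\<exists>a b. a \<le> b \<and> b \<le> Q \<and> \<bar>real b - real a - (v - u) * real Q\<bar> \<le> 3 \<and>
    (\<forall>V y. real V \<le> y * real Q \<longrightarrow> y * real Q \<le> real V + 1 \<longrightarrow> a \<le> V \<longrightarrow> V < b \<longrightarrow> u \<le> y \<and> y < v)"
proof (cases "Q = 0")
  case False
  define a where "a = nat \<lceil>u * real Q\<rceil>"
  \<comment> \<open>The \<open>- 1\<close> yields \<open>V + 1 < v * Q\<close> for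
    \<open>V < b\<close>, as the point may sit at the right end of its cell. The \<open>max\<close>
    gives an empty range when no cell fits.\<close>
  define b where "b = max a (nat (\<lceil>v * real Q\<rceil> - 1))"
  have le: "0 \<le> u * real Q" "u * real Q \<le> v * real Q" "v * real Q \<le> real Q"
    using assms by (auto intro: mult_right_mono mult_left_le_one_le)
  have "u \<le> y \<and> y < v"
    if "real V \<le> y * real Q" "y * real Q \<le> real V + 1" "a \<le> V" "V < b" for V y
  proof -
    have "u * real Q \<le> y * real Q" "y * real Q < v * real Q"
      using that le unfolding a_def b_def by linarith+
    then show ?thesis
      using False by auto
  qed
  moreover have "b \<le> Q" "a \<le> b"
    using le unfolding a_def b_def by linarith+
  moreover have "\<bar>real b - real a - (v * real Q - u * real Q)\<bar> \<le> 3"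
    using le unfolding a_def b_def by linarith
  ultimately show ?thesis
    by (intro exI[of _ a] exI[of _ b]) (auto simp: left_diff_distrib)
qed (use assms in auto)

lemma outer_grid_interval:
  fixes u v :: real
  assumes "0 \<le> u" "u \<le> v" "v \<le> 1"
  shows "\<exists>a b. a \<le> b \<and> b \<le> Q \<and> \<bar>real b - real a - (v - u) * real Q\<bar> \<le> 3 \<and>
    (\<forall>V y. real V \<le> y * real Q \<longrightarrow> y * real Q \<le> real V + 1 \<longrightarrow> u \<le> y \<longrightarrow> y < v \<longrightarrow> Q > 0 \<longrightarrow>
       a \<le> V \<and> V < b)"
proof -
  \<comment> \<open>One cell further left than rounding up: a point with \<open>y = u\<close> on the
    grid may carry the digits of the cell ending at \<open>u\<close>.\<close>
  define a where "a = nat (\<lceil>u * real Q\<rceil> - 1)"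
  define b where "b = nat \<lceil>v * real Q\<rceil>"
  have le: "0 \<le> u * real Q" "u * real Q \<le> v * real Q" "v * real Q \<le> real Q"
    using assms by (auto intro: mult_right_mono mult_left_le_one_le)
  have "a \<le> V \<and> V < b"
    if "real V \<le> y * real Q" "y * real Q \<le> real V + 1" "u \<le> y" "y < v" "Q > 0" for V y
  proof -
    have "u * real Q \<le> y * real Q" "y * real Q < v * real Q"
      using that by auto
    then show ?thesis
      using that(1,2) unfolding a_def b_def by linarith
  qed
  moreover have "b \<le> Q" "a \<le> b"
    using le unfolding a_def b_def by linarith+
  moreover have "\<bar>real b - real a - (v * real Q - u * real Q)\<bar> \<le> 3"
    using le unfolding a_def b_def by linarith
  ultimately show ?thesis
    by (intro exI[of _ a] exI[of _ b]) (auto simp: left_diff_distrib)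
qed

section \<open>Counting Kronecker points in one block and one residue class\<close>

definition kronecker_digit :: "'p::prime_card mod_ring fls \<Rightarrow> nat \<Rightarrow> nat \<Rightarrow> nat" where
  "kronecker_digit L n j = residue_nat (frac_coeff L (digit_poly n) j)"

lemma kronecker_digit_less: "kronecker_digit L n j < CARD('p)"
  for L :: "'p::prime_card mod_ring fls"
  by (simp add: kronecker_digit_def residue_nat_less)

lemma kronecker_seq_eq:
  "kronecker_seq L n = (\<Sum>j. real (kronecker_digit L n j) / real CARD('p) ^ Suc j)"
  for L :: "'p::prime_card mod_ring fls"
  by (simp add: kronecker_seq_def kronecker_digit_def frac_coeff_def real_residue_nat)

lemma digit_poly_eq_iff_poly_nat: "digit_poly n = f \<longleftrightarrow> n = poly_nat f"
  by auto

text \<open>The block prescribes the high coefficients \<open>F\<close>. Reducing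
  \<open>R - F\<close> modulo \<open>B\<close> gives a correction \<open>r\<close> that stays inside
  the block since \<open>degree B <= i\<close>; all other members differ from \<open>F + r\<close>
  by multiples of \<open>B\<close> lying in \<open>polys_below i\<close>.\<close>

lemma residue_class_block:
  fixes B R :: "'p::prime_card mod_ring poly"
  assumes "B \<noteq> 0" "degree B \<le> i"
  shows "\<exists>G. bij_betw (\<lambda>h. poly_nat (G + B * h)) (polys_below (i - degree B))
    {n. n div CARD('p) ^ i = c \<and> B dvd digit_poly n - R}"
proof -
  define F where "F = Polynomial.monom 1 i * (digit_poly c :: 'p mod_ring poly)"
  define r where "r = (R - F) mod B"
  define G where "G = F + r"
  have r: "r \<in> polys_below i"
    using assms degree_mod_less[of B "R - F"] by (auto simp: r_def polys_below_iff)
  have "B dvd (R - F) - r"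
    by (simp add: r_def minus_mod_eq_mult_div)
  then have BG: "B dvd R - G"
    by (simp add: G_def algebra_simps)
  have below: "B * h \<in> polys_below i \<longleftrightarrow> h \<in> polys_below (i - degree B)" for h
    using assms degree_mult_eq[of B h] by (cases "h = 0") (auto simp: polys_below_iff)
  have mem: "n div CARD('p) ^ i = c \<and> B dvd digit_poly n - R \<longleftrightarrow>
      (\<exists>h\<in>polys_below (i - degree B). digit_poly n = G + B * h)" for n
  proof
    assume *: "n div CARD('p) ^ i = c \<and> B dvd digit_poly n - R"
    then have "B dvd (digit_poly n - R) + (R - G)"
      using BG by (intro dvd_add) auto
    then obtain h where h: "digit_poly n - G = B * h"
      by (auto simp: dvd_def)
    have "digit_poly n - F \<in> polys_below i"
      using * by (simp add: div_power_eq_iff_digit_poly F_def)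
    then have "digit_poly n - F - r \<in> polys_below i"
      using r by (rule polys_below_closed(2))
    then have "B * h \<in> polys_below i"
      by (simp add: h[symmetric] G_def diff_diff_eq)
    then show "\<exists>h\<in>polys_below (i - degree B). digit_poly n = G + B * h"
      using h below by (intro bexI[of _ h]) (auto simp: algebra_simps)
  next
    assume "\<exists>h\<in>polys_below (i - degree B). digit_poly n = G + B * h"
    then obtain h where h: "h \<in> polys_below (i - degree B)" "digit_poly n = G + B * h"
      by blast
    have "r + B * h \<in> polys_below i"
      using h(1) r unfolding below[symmetric] by (intro polys_below_closed(1))
    then have "digit_poly n - F \<in> polys_below i"
      by (simp add: h(2) G_def add.assoc)
    moreover have "B dvd B * h - (R - G)"
      by (rule dvd_diff[OF dvd_triv_left BG])
    ultimately show "n div CARD('p) ^ i = c \<and> B dvd digit_poly n - R"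
      by (simp add: div_power_eq_iff_digit_poly F_def h(2) algebra_simps)
  qed
  have "{n. n div CARD('p) ^ i = c \<and> B dvd digit_poly n - R}
      = (\<lambda>h. poly_nat (G + B * h)) ` polys_below (i - degree B)"
    unfolding mem digit_poly_eq_iff_poly_nat by auto
  moreover have "inj_on (\<lambda>h. poly_nat (G + B * h)) (polys_below (i - degree B))"
    using assms by (auto simp: inj_on_def poly_nat_eq_iff)
  ultimately show ?thesis
    by (auto simp: bij_betw_def)
qed

lemma card_residue_class_block:
  fixes B R :: "'p::prime_card mod_ring poly"
  assumes "B \<noteq> 0" "degree B \<le> i"
  shows "card {n. n div CARD('p) ^ i = c \<and> B dvd digit_poly n - R} = CARD('p) ^ (i - degree B)"
    and "finite {n. n div CARD('p) ^ i = c \<and> B dvd digit_poly n - R}"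
proof -
  obtain G where "bij_betw (\<lambda>h. poly_nat (G + B * h)) (polys_below (i - degree B))
    {n. n div CARD('p) ^ i = c \<and> B dvd digit_poly n - R}"
    using residue_class_block[OF assms] by blast
  note * = bij_betw_same_card[OF this] bij_betw_finite[OF this]
  show "card {n. n div CARD('p) ^ i = c \<and> B dvd digit_poly n - R} = CARD('p) ^ (i - degree B)"
    using *(1) by (simp add: card_polys_below)
  show "finite {n. n div CARD('p) ^ i = c \<and> B dvd digit_poly n - R}"
    using *(2) by simp
qed

text \<open>The digits of \<open>G + B * h\<close> are fixed shifts of the digits of
  \<open>h\<close> relative to \<open>B * L\<close>. This is a system of \<open>s\<close>
  independent equations in \<open>i - degree B\<close> unknowns, and the surplus
  \<open>degree B + K\<close> is the exponent of the count.\<close>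

lemma card_kronecker_fiber:
  fixes B R :: "'p::prime_card mod_ring poly" and L :: "'p mod_ring fls"
  assumes bad: "\<And>Q. Q \<noteq> 0 \<Longrightarrow> \<exists>l < degree Q + K. frac_coeff L Q l \<noteq> 0"
  assumes "B \<noteq> 0" and i: "s + 2 * degree B + K = i" and W: "W < CARD('p) ^ s"
  shows "card {n. n div CARD('p) ^ i = c \<and> B dvd digit_poly n - R \<and>
      digit_value CARD('p) (kronecker_digit L n) s = W} = CARD('p) ^ (degree B + K)"
proof -
  let ?D = "degree B"
  let ?m = "i - ?D"
  have le: "?D \<le> i" and m: "?m = ?D + K + s"
    using i by simp_all
  obtain G where G: "bij_betw (\<lambda>h. poly_nat (G + B * h)) (polys_below ?m)
    {n. n div CARD('p) ^ i = c \<and> B dvd digit_poly n - R}"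
    using residue_class_block[OF \<open>B \<noteq> 0\<close> le] by blast
  have "\<exists>w. (\<forall>j<s. w j < CARD('p)) \<and>
      (\<forall>n. digit_value CARD('p) (kronecker_digit L n) s = W \<longleftrightarrow> (\<forall>j<s. kronecker_digit L n j = w j))"
    by (rule digit_value_eq_iff[OF _ W]) (rule kronecker_digit_less)
  then obtain w where wp: "\<forall>j<s. w j < CARD('p)"
    and w: "\<And>n. digit_value CARD('p) (kronecker_digit L n) s = W
      \<longleftrightarrow> (\<forall>j<s. kronecker_digit L n j = w j)"
    by (elim exE conjE) (rule that, auto)
  have mult: "frac_coeff (poly_to_fls B * L) h j = frac_coeff L (B * h) j" for h j
    by (simp add: frac_coeff_def poly_to_fls_mult mult_ac)
  define w' where "w' j = of_nat (w j) - frac_coeff L G j" for j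
  have digit: "kronecker_digit L (poly_nat (G + B * h)) j = w j
      \<longleftrightarrow> frac_coeff (poly_to_fls B * L) h j = w' j" if "j < s" for h j
  proof -
    have "kronecker_digit L (poly_nat (G + B * h)) j = w j \<longleftrightarrow> frac_coeff L (G + B * h) j = of_nat (w j)"
      using wp that residue_nat_of_nat[where 'p = 'p, of "w j"]
      by (auto simp: kronecker_digit_def simp flip: residue_nat_inject)
    then show ?thesis
      by (simp add: w'_def frac_coeff_add mult eq_diff_eq add.commute)
  qed
  have "bij_betw (\<lambda>h. poly_nat (G + B * h))
      {h \<in> polys_below ?m. \<forall>j<s. frac_coeff (poly_to_fls B * L) h j = w' j}
      {n. n div CARD('p) ^ i = c \<and> B dvd digit_poly n - R \<and> (\<forall>j<s. kronecker_digit L n j = w j)}"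
    (is "bij_betw ?f ?H ?T")
    unfolding bij_betw_def
  proof
    show "inj_on ?f ?H"
      using G by (auto simp: bij_betw_def intro: inj_on_subset)
    have "?T = {n \<in> ?f ` polys_below ?m. \<forall>j<s. kronecker_digit L n j = w j}"
      using G by (simp add: bij_betw_def)
    also have "\<dots> = ?f ` ?H"
      using digit by auto
    finally show "?f ` ?H = ?T" ..
  qed
  then have "card {n. n div CARD('p) ^ i = c \<and> B dvd digit_poly n - R \<and>
      digit_value CARD('p) (kronecker_digit L n) s = W}
    = card {h \<in> polys_below ?m. \<forall>j<s. frac_coeff (poly_to_fls B * L) h j = w' j}"
    by (simp add: w bij_betw_same_card)
  moreover have "card {h \<in> polys_below ?m. \<forall>j<s. frac_coeff (poly_to_fls B * L) h j = w' j}
      * CARD('p mod_ring) ^ s = CARD('p mod_ring) ^ ?m"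
  proof (rule card_frac_coeff_fiber)
    \<comment> \<open>Applying \<open>bad\<close> to \<open>B * Q\<close> gives a digit position
      below \<open>degree B + degree Q + K\<close>, hence below the number
      \<open>degree B + K + s\<close> of unknowns; this dictates the relation between
      \<open>s\<close> and \<open>i\<close>.\<close>
    fix Q :: "'p mod_ring poly" assume Q: "Q \<noteq> 0" "degree Q < s"
    then obtain l where "l < degree (B * Q) + K" "frac_coeff L (B * Q) l \<noteq> 0"
      using bad[of "B * Q"] \<open>B \<noteq> 0\<close> by auto
    then show "\<exists>l<?m. frac_coeff (poly_to_fls B * L) Q l \<noteq> 0"
      using Q \<open>B \<noteq> 0\<close> i by (intro exI[of _ l]) (auto simp: mult degree_mult_eq)
  qed
  moreover have "CARD('p) ^ ?m = CARD('p) ^ (?D + K) * CARD('p) ^ s"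
    by (simp add: m power_add)
  ultimately show ?thesis by simp
qed

lemma card_kronecker_range:
  fixes B R :: "'p::prime_card mod_ring poly" and L :: "'p mod_ring fls"
  assumes bad: "\<And>Q. Q \<noteq> 0 \<Longrightarrow> \<exists>l < degree Q + K. frac_coeff L Q l \<noteq> 0"
  assumes "B \<noteq> 0" and i: "s + 2 * degree B + K = i" and b: "b \<le> CARD('p) ^ s"
  shows "card {n. n div CARD('p) ^ i = c \<and> B dvd digit_poly n - R \<and>
      a \<le> digit_value CARD('p) (kronecker_digit L n) s \<and> digit_value CARD('p) (kronecker_digit L n) s < b}
    = (b - a) * CARD('p) ^ (degree B + K)"
proof -
  let ?T = "\<lambda>W. {n. n div CARD('p) ^ i = c \<and> B dvd digit_poly n - R \<and>
      digit_value CARD('p) (kronecker_digit L n) s = W}"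
  have le: "degree B \<le> i" using i by simp
  have fin: "finite (?T W)" for W
    by (rule finite_subset[OF _ card_residue_class_block(2)[OF \<open>B \<noteq> 0\<close> le, of c R]]) auto
  have "{n. n div CARD('p) ^ i = c \<and> B dvd digit_poly n - R \<and>
      a \<le> digit_value CARD('p) (kronecker_digit L n) s \<and> digit_value CARD('p) (kronecker_digit L n) s < b}
    = (\<Union>W\<in>{a..<b}. ?T W)"
    by auto
  also have "card \<dots> = (\<Sum>W\<in>{a..<b}. card (?T W))"
    using fin by (intro card_UN_disjoint) auto
  also have "\<dots> = (\<Sum>W\<in>{a..<b}. CARD('p) ^ (degree B + K))"
    using b by (intro sum.cong refl card_kronecker_fiber[OF bad \<open>B \<noteq> 0\<close> i]) auto
  finally show ?thesis by simp
qed

lemma kronecker_seq_bounds: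
  fixes L :: "'p::prime_card mod_ring fls"
  shows "real (digit_value CARD('p) (kronecker_digit L n) s) \<le> kronecker_seq L n * real (CARD('p) ^ s)"
    and "kronecker_seq L n * real (CARD('p) ^ s) \<le> real (digit_value CARD('p) (kronecker_digit L n) s) + 1"
  unfolding kronecker_seq_eq of_nat_power by (intro digit_value_bounds kronecker_digit_less)+

text \<open>The first bound merely counts the class and serves large \<open>degree B\<close>; the
  second rests on equidistribution and serves small \<open>degree B\<close>. Both cover blocks of
  every length, so blocks can be summed uniformly.\<close>

lemma kronecker_block_discrepancy:
  fixes B R :: "'p::prime_card mod_ring poly" and L :: "'p mod_ring fls"
    and i c :: nat
  assumes bad: "\<And>Q. Q \<noteq> 0 \<Longrightarrow> \<exists>l < degree Q + K. frac_coeff L Q l \<noteq> 0"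
  assumes B: "B \<noteq> 0" and uv: "0 \<le> u" "u \<le> v" "v \<le> 1"
  defines "T \<equiv> {n. n div CARD('p) ^ i = c \<and> B dvd digit_poly n - R}"
  defines "S \<equiv> {n \<in> T. u \<le> kronecker_seq L n \<and> kronecker_seq L n < v}"
  defines "e \<equiv> (v - u) * (real (CARD('p) ^ i) / real (CARD('p) ^ degree B))"
  shows "\<bar>real (card S) - e\<bar> \<le> real (CARD('p) ^ i) / real (CARD('p) ^ degree B) + 1"
    and "\<bar>real (card S) - e\<bar> \<le> 4 * real (CARD('p) ^ (degree B + K))"
proof -
  define p where "p = CARD('p)"
  define D where "D = degree B"
  have p1: "p > 1"
    using CARD_prime_gt_1[where 'p = 'p] by (simp add: p_def)
  have ge1: "1 \<le> real (p ^ k)" for k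
    using p1 by simp
  have e: "0 \<le> e" "e \<le> real (p ^ i) / real (p ^ D)"
    using uv mult_right_mono[of "v - u" 1 "real (p ^ i) / real (p ^ D)"]
    unfolding e_def p_def D_def by auto
  show "\<bar>real (card S) - e\<bar> \<le> real (CARD('p) ^ i) / real (CARD('p) ^ degree B) + 1"
    and "\<bar>real (card S) - e\<bar> \<le> 4 * real (CARD('p) ^ (degree B + K))"
    unfolding p_def[symmetric] D_def[symmetric]
  proof -
    have main: "\<bar>real (card S) - e\<bar> \<le> real (p ^ i) / real (p ^ D) + 1 \<and>
      \<bar>real (card S) - e\<bar> \<le> 4 * real (p ^ (D + K))"
    proof (cases "i < D")
      case True
      \<comment> \<open>Two members differ by a multiple of \<open>B\<close> of degree below
        \<open>i < degree B\<close>, which must be zero.\<close>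
      have "n = n'" if "n \<in> S" "n' \<in> S" for n n'
      proof -
        let ?F = "Polynomial.monom 1 i * (digit_poly c :: 'p mod_ring poly)"
        have "B dvd (digit_poly n - R) - (digit_poly n' - R)"
          by (rule dvd_diff) (use that in \<open>simp_all add: S_def T_def\<close>)
        then have dvd: "B dvd digit_poly n - digit_poly n'"
          by simp
        have "(digit_poly n - ?F) - (digit_poly n' - ?F) \<in> polys_below i"
          by (rule polys_below_closed(2))
            (use that in \<open>simp_all add: S_def T_def flip: div_power_eq_iff_digit_poly\<close>)
        then have "digit_poly n - (digit_poly n' :: 'p mod_ring poly) \<in> polys_below i"
          by simp
        then show ?thesis
          using dvd_imp_degree_le[OF dvd] True unfolding polys_below_iff D_def by (cases "n = n'") auto
      qed
      then have "card S \<le> 1"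
        by (cases "finite S") (auto simp: card_le_Suc0_iff_eq)
      moreover have "real (p ^ i) / real (p ^ D) \<le> 1"
        using True p1 by (simp add: power_increasing)
      ultimately have "\<bar>real (card S) - e\<bar> \<le> 1"
        using e by linarith
      then show ?thesis
        using ge1[of "D + K"] by (auto intro: order.trans)
    next
      case False
      then have le: "degree B \<le> i" by (simp add: D_def)
      have finT: "finite T" and cardT: "card T = p ^ (i - D)"
        unfolding T_def p_def D_def using card_residue_class_block[OF B le] by auto
      have "card S \<le> card T"
        using finT by (intro card_mono) (auto simp: S_def)
      moreover have pow: "real (p ^ i) / real (p ^ D) = real (p ^ (i - D))"
      proof -
        have "p ^ i = p ^ (i - D) * p ^ D"
          using False by (simp flip: power_add)
        then show ?thesis
          using p1 by simp
      qed
      ultimately have triv: "\<bar>real (card S) - e\<bar> \<le> real (p ^ (i - D))"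
        using e cardT by linarith
      have "\<bar>real (card S) - e\<bar> \<le> 4 * real (p ^ (D + K))"
      \<comment> \<open>A block too short to resolve a digit contains at most
        \<open>p^(D + K)\<close> members of the class.\<close>
      proof (cases "i \<le> 2 * D + K")
        case True
        then have "real (p ^ (i - D)) \<le> real (p ^ (D + K))"
          using p1 by (simp add: power_increasing)
        then show ?thesis
          using triv ge1[of "D + K"] by linarith
      next
        case False
        define s where "s = i - (2 * D + K)"
        have i: "s + 2 * degree B + K = i"
          using False by (simp add: s_def D_def)
        have "i - D = s + (D + K)"
          using False by (simp add: s_def)
        then have "real (p ^ (i - D)) = real (p ^ s) * real (p ^ (D + K))"
          by (simp add: power_add)
        then have e_eq: "e = (v - u) * real (p ^ s) * real (p ^ (D + K))"
          by (simp only: e_def p_def[symmetric] D_def[symmetric] pow mult.assoc)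
        define V where "V n = digit_value p (kronecker_digit L n) s" for n
        have range: "card {n \<in> T. a \<le> V n \<and> V n < b} = (b - a) * p ^ (D + K)" if "b \<le> p ^ s" for a b
          using card_kronecker_range[OF bad B i, of b c R a] that
          by (simp add: T_def V_def p_def D_def conj_assoc)
        have bounds: "real (V n) \<le> kronecker_seq L n * real (p ^ s)"
          "kronecker_seq L n * real (p ^ s) \<le> real (V n) + 1" for n
          unfolding V_def p_def by (rule kronecker_seq_bounds)+
        obtain a b where ab: "a \<le> b" "b \<le> p ^ s" "\<bar>real b - real a - (v - u) * real (p ^ s)\<bar> \<le> 3"
          "\<And>V y. real V \<le> y * real (p ^ s) \<Longrightarrow> y * real (p ^ s) \<le> real V + 1 \<Longrightarrow> a \<le> V \<Longrightarrow> V < b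
            \<Longrightarrow> u \<le> y \<and> y < v"
          using inner_grid_interval[OF uv, of "p ^ s"] by blast
        obtain a' b' where ab': "a' \<le> b'" "b' \<le> p ^ s" "\<bar>real b' - real a' - (v - u) * real (p ^ s)\<bar> \<le> 3"
          "\<And>V y. real V \<le> y * real (p ^ s) \<Longrightarrow> y * real (p ^ s) \<le> real V + 1 \<Longrightarrow> u \<le> y \<Longrightarrow> y < v
            \<Longrightarrow> p ^ s > 0 \<Longrightarrow> a' \<le> V \<and> V < b'"
          using outer_grid_interval[OF uv, of "p ^ s"] by blast
        have "{n \<in> T. a \<le> V n \<and> V n < b} \<subseteq> S"
          unfolding S_def using ab(4)[OF bounds] by blast
        then have "card {n \<in> T. a \<le> V n \<and> V n < b} \<le> card S"
          using finT by (intro card_mono) (auto simp: S_def)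
        then have "real ((b - a) * p ^ (D + K)) \<le> real (card S)"
          unfolding range[OF ab(2)] by (simp only: of_nat_le_iff)
        then have lower: "(real b - real a) * real (p ^ (D + K)) \<le> real (card S)"
          by (simp only: of_nat_mult of_nat_diff[OF ab(1)])
        have "p ^ s > 0"
          using p1 by simp
        then have "S \<subseteq> {n \<in> T. a' \<le> V n \<and> V n < b'}"
          unfolding S_def using ab'(4)[OF bounds] by blast
        then have "card S \<le> card {n \<in> T. a' \<le> V n \<and> V n < b'}"
          using finT by (intro card_mono) auto
        then have "real (card S) \<le> real ((b' - a') * p ^ (D + K))"
          unfolding range[OF ab'(2)] by (simp only: of_nat_le_iff)
        then have upper: "real (card S) \<le> (real b' - real a') * real (p ^ (D + K))"
          by (simp only: of_nat_mult of_nat_diff[OF ab'(1)])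
        \<comment> \<open>Every grid cell contains exactly \<open>p^(D + K)\<close> members, so an
          uncertainty of 3 cells costs three times this number.\<close>
        have "((v - u) * real (p ^ s) - 3) * real (p ^ (D + K)) \<le> (real b - real a) * real (p ^ (D + K))"
          using ab(3) by (intro mult_right_mono) auto
        moreover have "(real b' - real a') * real (p ^ (D + K)) \<le> ((v - u) * real (p ^ s) + 3) * real (p ^ (D + K))"
          using ab'(3) by (intro mult_right_mono) auto
        ultimately have "\<bar>real (card S) - e\<bar> \<le> 3 * real (p ^ (D + K))"
          using lower upper unfolding e_eq by (simp only: left_diff_distrib distrib_right)
        then show ?thesis
          using ge1[of "D + K"] by linarith
      qed
      moreover have "\<bar>real (card S) - e\<bar> \<le> real (p ^ i) / real (p ^ D) + 1"
        using triv pow by linarith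
      ultimately show ?thesis by blast
    qed
    show "\<bar>real (card S) - e\<bar> \<le> real (p ^ i) / real (p ^ D) + 1"
      using main by blast
    show "\<bar>real (card S) - e\<bar> \<le> 4 * real (p ^ (D + K))"
      using main by blast
  qed
qed

text \<open>The blocks tile the integers below \<open>N\<close> exactly, so the restriction
  \<open>n < N\<close> disappears inside each of them and only complete blocks are counted.\<close>

lemma card_less_blocks:
  assumes "q > 1" "N \<le> q ^ M"
  shows "\<exists>F :: (nat \<times> nat) set. finite F \<and> card F \<le> 2 * q * (M + 1) \<and> (\<Sum>(k, c)\<in>F. q ^ k) = N \<and>
    (\<forall>P. card {n. n < N \<and> P n} = (\<Sum>(k, c)\<in>F. card {n. n div q ^ k = c \<and> P n}))"
proof -
  obtain F :: "(nat \<times> nat) set" where F: "finite F" "card F \<le> 2 * q * (M + 1)"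
    "\<And>x. of_bool (0 \<le> x \<and> x < N) = (\<Sum>(k, c)\<in>F. of_bool (x div q ^ k = c) :: nat)"
    "(\<Sum>(k, c)\<in>F. q ^ k) = N"
    using q_adic_decomposition[OF assms(1) _ assms(2), of 0] by auto
  have less: "x < N" if "(k, c) \<in> F" "x div q ^ k = c" for x k c
  proof -
    have "(1::nat) \<le> (\<Sum>(k, c)\<in>F. of_bool (x div q ^ k = c))"
      using member_le_sum[OF that(1), of "\<lambda>(k, c). of_bool (x div q ^ k = c) :: nat"] F(1) that(2) by auto
    then show ?thesis
      using F(3)[of x] by (cases "x < N") auto
  qed
  have "card {n. n < N \<and> P n} = (\<Sum>(k, c)\<in>F. card {n. n div q ^ k = c \<and> P n})" for P
  proof -
    define A where "A = {n. n < N \<and> P n}"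
    have "card A = (\<Sum>n\<in>A. of_bool (0 \<le> n \<and> n < N))"
      by (simp add: A_def)
    also have "\<dots> = (\<Sum>n\<in>A. \<Sum>(k, c)\<in>F. of_bool (n div q ^ k = c))"
      by (simp only: F(3))
    also have "\<dots> = (\<Sum>(k, c)\<in>F. \<Sum>n\<in>A. of_bool (n div q ^ k = c))"
      by (subst sum.swap) (simp add: case_prod_unfold)
    also have "\<dots> = (\<Sum>(k, c)\<in>F. card {n. n div q ^ k = c \<and> P n})"
    proof (intro sum.cong refl, safe)
      fix k c assume "(k, c) \<in> F"
      then have "{n. n div q ^ k = c \<and> P n} = {n \<in> A. n div q ^ k = c}"
        using less by (auto simp: A_def)
      moreover have "finite A" by (simp add: A_def)
      ultimately show "(\<Sum>n\<in>A. of_bool (n div q ^ k = c)) = card {n. n div q ^ k = c \<and> P n}"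
        by (simp add: sum_of_bool_eq Int_def)
    qed
    finally show ?thesis by (simp add: A_def)
  qed
  with F show ?thesis by blast
qed

text \<open>For \<open>p^(2D) < N\<close> each block contributes at most \<open>O(p^D)\<close>; otherwise the residue class itself has
  only \<open>O(sqrt N)\<close> elements below \<open>N\<close>, up to the number of blocks.\<close>

lemma kronecker_residue_class_discrepancy:
  fixes B R :: "'p::prime_card mod_ring poly" and L :: "'p mod_ring fls"
  assumes bad: "\<And>Q. Q \<noteq> 0 \<Longrightarrow> \<exists>l < degree Q + K. frac_coeff L Q l \<noteq> 0"
  assumes B: "B \<noteq> 0" and uv: "0 \<le> u" "u \<le> v" "v \<le> 1"
  assumes N: "N \<ge> 1" "N \<le> CARD('p) ^ M"
  shows "\<bar>real (card {n. n < N \<and> B dvd digit_poly n - R \<and> u \<le> kronecker_seq L n \<and> kronecker_seq L n < v})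
      - real N * (v - u) / real (CARD('p) ^ degree B)\<bar>
    \<le> 8 * real (CARD('p) ^ (K + 1)) * real (M + 1) * sqrt (real N)"
proof -
  define p where "p = CARD('p)"
  define D where "D = degree B"
  have p1: "p > 1"
    using CARD_prime_gt_1[where 'p = 'p] by (simp add: p_def)
  have pD: "real (p ^ D) > 0" using p1 by simp
  define P where "P n \<longleftrightarrow> B dvd digit_poly n - R \<and> u \<le> kronecker_seq L n \<and> kronecker_seq L n < v" for n
  obtain F :: "(nat \<times> nat) set" where F: "finite F" "card F \<le> 2 * p * (M + 1)" "(\<Sum>(k, c)\<in>F. p ^ k) = N"
    "\<And>P. card {n. n < N \<and> P n} = (\<Sum>(k, c)\<in>F. card {n. n div p ^ k = c \<and> P n})"
    using card_less_blocks[OF p1 N(2)[folded p_def]] by blast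
  have FN: "real N = (\<Sum>x\<in>F. real (p ^ fst x))"
    unfolding F(3)[symmetric] by (simp add: case_prod_unfold)
  define err where "err x = real (card {n. n div p ^ fst x = snd x \<and> P n}) - (v - u) * (real (p ^ fst x) / real (p ^ D))" for x
  have err: "\<bar>err x\<bar> \<le> real (p ^ fst x) / real (p ^ D) + 1" "\<bar>err x\<bar> \<le> 4 * real (p ^ (D + K))" for x
    using kronecker_block_discrepancy[OF bad B uv, of "fst x" "snd x" R]
    by (simp_all add: err_def P_def p_def D_def conj_assoc)
  have "real (card {n. n < N \<and> P n}) - real N * (v - u) / real (p ^ D) = (\<Sum>x\<in>F. err x)"
    unfolding F(4) FN by (simp add: case_prod_unfold err_def sum_subtractf sum_distrib_left sum_distrib_right
        sum_divide_distrib mult_ac)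
  then have "\<bar>real (card {n. n < N \<and> P n}) - real N * (v - u) / real (p ^ D)\<bar> \<le> (\<Sum>x\<in>F. \<bar>err x\<bar>)"
    by simp
  also have "\<dots> \<le> 8 * real (p ^ (K + 1)) * real (M + 1) * sqrt (real N)"
  proof -
    have cF: "real (card F) \<le> 2 * real p * real (M + 1)"
      using of_nat_mono[OF F(2), where 'a = real] by (simp only: of_nat_mult of_nat_numeral)
    have sq: "1 \<le> sqrt (real N)" using N by simp
    have pK: "real p \<le> real (p ^ (K + 1))" "1 \<le> real (p ^ (K + 1))"
      using p1 by (auto simp del: power_Suc intro: self_le_power)
    have M1: "1 \<le> real (M + 1)" by simp
    show ?thesis
    \<comment> \<open>The 8 is \<open>2 * 4\<close>: at most \<open>2 * p * (M + 1)\<close> blocks,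
      each with error at most \<open>4 * p^(D + K)\<close>. In the second case the class densities
      sum to \<open>N / p^D\<close>, plus 1 for each block.\<close>
    proof (cases "real (p ^ D) \<le> sqrt (real N)")
      case True
      have "(\<Sum>x\<in>F. \<bar>err x\<bar>) \<le> (\<Sum>x\<in>F. 4 * real (p ^ (D + K)))"
        by (intro sum_mono err)
      also have "\<dots> = real (card F) * (4 * real (p ^ K) * real (p ^ D))"
        by (simp add: power_add)
      also have "\<dots> \<le> (2 * real p * real (M + 1)) * (4 * real (p ^ K) * sqrt (real N))"
        using cF True by (intro mult_mono) auto
      finally show ?thesis by (simp add: algebra_simps)
    next
      case False
      then have "sqrt (real N) * sqrt (real N) \<le> sqrt (real N) * real (p ^ D)"
        by (intro mult_left_mono) auto
      then have "real N / real (p ^ D) \<le> sqrt (real N)"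
        using pD by (simp add: divide_le_eq)
      have "(\<Sum>x\<in>F. \<bar>err x\<bar>) \<le> (\<Sum>x\<in>F. real (p ^ fst x) / real (p ^ D) + 1)"
        by (intro sum_mono err)
      also have "\<dots> = real N / real (p ^ D) + real (card F)"
        unfolding FN by (simp add: sum.distrib sum_divide_distrib)
      also have "\<dots> \<le> sqrt (real N) + 2 * real p * real (M + 1)"
        using cF \<open>real N / real (p ^ D) \<le> sqrt (real N)\<close> by linarith
      also have "\<dots> \<le> real (p ^ (K + 1)) * real (M + 1) * sqrt (real N)
          + 2 * real (p ^ (K + 1)) * real (M + 1) * sqrt (real N)"
      proof (rule add_mono)
        show "sqrt (real N) \<le> real (p ^ (K + 1)) * real (M + 1) * sqrt (real N)"
          using mult_mono[OF pK(2) M1] sq by (simp add: mult_le_cancel_right1)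
        have "2 * real p * real (M + 1) * 1 \<le> 2 * real (p ^ (K + 1)) * real (M + 1) * sqrt (real N)"
          using pK(1) sq by (intro mult_mono) auto
        then show "2 * real p * real (M + 1) \<le> 2 * real (p ^ (K + 1)) * real (M + 1) * sqrt (real N)"
          by simp
      qed
      also have "\<dots> \<le> 8 * real (p ^ (K + 1)) * real (M + 1) * sqrt (real N)"
      proof -
        have "0 \<le> real (p ^ (K + 1)) * real (M + 1) * sqrt (real N)" by simp
        then show ?thesis by linarith
      qed
      finally show ?thesis .
    qed
  qed
  finally show ?thesis
    by (simp add: P_def p_def D_def)
qed

section \<open>The Halton sequence and residue classes\<close>

text \<open>For nonconstant \<open>b\<close> these are digits in the integer base
  \<open>p^(degree b)\<close>. The van der Corput point has an ordinary expansion in that base, so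
  the \<open>digit_value\<close> lemmas apply.\<close>

definition vdc_digit :: "'p::prime_card mod_ring poly \<Rightarrow> nat \<Rightarrow> nat \<Rightarrow> nat" where
  "vdc_digit b n i = poly_nat ((digit_poly n div b ^ i) mod b)"

lemma vdc_digit_less:
  fixes b :: "'p::prime_card mod_ring poly"
  assumes "degree b \<ge> 1"
  shows "vdc_digit b n i < CARD('p) ^ degree b"
proof -
  have "b \<noteq> 0" using assms by auto
  then show ?thesis
    unfolding vdc_digit_def poly_nat_less_iff polys_below_iff by (rule degree_mod_less)
qed

text \<open>A nonzero \<open>n(X)\<close> has degree below \<open>n\<close>, hence below the degree
  of \<open>b^i\<close>. This turns the finite sum defining the point into a series.\<close>

lemma vdc_digit_eq_0:
  fixes b :: "'p::prime_card mod_ring poly"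
  assumes "degree b \<ge> 1" "i > n"
  shows "vdc_digit b n i = 0"
proof -
  have "b \<noteq> 0" using assms by auto
  have "n < CARD('p) ^ n"
    by (rule power_gt_expt) (use CARD_prime_gt_1[where 'p = 'p] in simp)
  then have "poly_nat (digit_poly n :: 'p mod_ring poly) < CARD('p) ^ n"
    by simp
  then have "digit_poly n = (0 :: 'p mod_ring poly) \<or> degree (digit_poly n :: 'p mod_ring poly) < n"
    by (simp only: poly_nat_less_iff polys_below_iff)
  moreover have "n < degree b * i"
    using mult_le_mono1[OF assms(1), of i] assms(2) by linarith
  ultimately have "digit_poly n div b ^ i = 0"
    using assms \<open>b \<noteq> 0\<close> by (auto simp: degree_power_eq mult.commute intro!: div_poly_less)
  then show ?thesis
    by (simp add: vdc_digit_def)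
qed

lemma vdc_seq_eq:
  fixes b :: "'p::prime_card mod_ring poly"
  assumes "degree b \<ge> 1"
  shows "vdc_seq b n = (\<Sum>i. real (vdc_digit b n i) / real (CARD('p) ^ degree b) ^ Suc i)"
proof -
  have "vdc_seq b n = (\<Sum>i\<le>n. real (vdc_digit b n i) / real (CARD('p) ^ degree b) ^ Suc i)"
    unfolding vdc_seq_def vdc_digit_def eval_at_p_eq_poly_nat of_nat_power Suc_eq_plus1 power_mult ..
  also have "\<dots> = (\<Sum>i. real (vdc_digit b n i) / real (CARD('p) ^ degree b) ^ Suc i)"
    using vdc_digit_eq_0[OF assms] by (intro suminf_finite[symmetric]) auto
  finally show ?thesis .
qed

lemma vdc_seq_bounds:
  fixes b :: "'p::prime_card mod_ring poly"
  assumes "degree b \<ge> 1"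
  defines "q \<equiv> CARD('p) ^ degree b"
  shows "real (digit_value q (vdc_digit b n) k) \<le> vdc_seq b n * real (q ^ k)"
    and "vdc_seq b n * real (q ^ k) \<le> real (digit_value q (vdc_digit b n) k) + 1"
  using digit_value_bounds[of "vdc_digit b n" q k] vdc_digit_less[OF assms(1)]
  by (simp_all add: vdc_seq_eq[OF assms(1)] q_def)

text \<open>The first \<open>k\<close> digits are the \<open>b\<close>-adic coefficients of
  \<open>n(X)\<close> modulo \<open>b^k\<close>, so fixing them fixes a residue. That
  \<open>R\<close> is reduced is carried along for the induction, which must separate it from the
  next coefficient.\<close>

lemma digit_value_vdc_eq_iff:
  fixes b :: "'p::prime_card mod_ring poly"
  assumes deg: "degree b \<ge> 1"
  defines "q \<equiv> CARD('p) ^ degree b"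
  assumes "c < q ^ k"
  shows "\<exists>R. R mod b ^ k = R \<and> (\<forall>n. digit_value q (vdc_digit b n) k = c \<longleftrightarrow> digit_poly n mod b ^ k = R)"
  using assms(3)
proof (induction k arbitrary: c)
  case (Suc k)
  have b0: "b \<noteq> 0" using deg by auto
  have q0: "q > 0" using CARD_prime_gt_1[where 'p = 'p] by (simp add: q_def)
  have "c div q < q ^ k"
    using Suc.prems by (simp add: less_mult_imp_div_less mult.commute)
  then obtain R where R: "R mod b ^ k = R"
    "\<And>n. digit_value q (vdc_digit b n) k = c div q \<longleftrightarrow> digit_poly n mod b ^ k = R"
    using Suc.IH by blast
  \<comment> \<open>Digit \<open>k\<close> is the least significant one of \<open>c\<close> but the
    highest \<open>b\<close>-adic coefficient of the residue: the digit reversal of the van der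
    Corput construction.\<close>
  define A where "A = (digit_poly (c mod q) :: 'p mod_ring poly)"
  have "poly_nat A < CARD('p) ^ degree b"
    using q0 by (simp add: A_def q_def)
  then have A: "A mod b = A"
    unfolding poly_nat_less_iff polys_below_iff by (auto simp: mod_poly_less)
  have expand: "P mod b ^ Suc k = b ^ k * (P div b ^ k mod b) + P mod b ^ k" for P
    unfolding power_Suc2 by (rule poly_mod_mult_right)
  have "b ^ k \<noteq> 0" using b0 by simp
  have R_div: "R div b ^ k = 0"
    using div_mult_mod_eq[of R "b ^ k"] R(1) b0 by auto
  have eq: "P mod b ^ Suc k = b ^ k * A + R \<longleftrightarrow> P div b ^ k mod b = A \<and> P mod b ^ k = R" for P
  proof
    assume *: "P mod b ^ Suc k = b ^ k * A + R"
    then have "(P mod b ^ Suc k) mod b ^ k = R"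
      using R(1) by simp
    then have "P mod b ^ k = R"
      by (simp add: expand del: power_Suc)
    with * show "P div b ^ k mod b = A \<and> P mod b ^ k = R"
      using b0 by (simp add: expand del: power_Suc)
  qed (simp add: expand del: power_Suc)
  have "(b ^ k * A + R) mod b ^ Suc k = b ^ k * A + R"
    unfolding eq using R_div R(1) A \<open>b ^ k \<noteq> 0\<close> by simp
  moreover have "digit_value q (vdc_digit b n) (Suc k) = c \<longleftrightarrow> digit_poly n mod b ^ Suc k = b ^ k * A + R" for n
  proof -
    have "vdc_digit b n k = c mod q \<longleftrightarrow> digit_poly n div b ^ k mod b = A"
      by (simp add: vdc_digit_def A_def digit_poly_eq_iff_poly_nat eq_commute[of _ "digit_poly _"])
        (metis eq_commute)
    then show ?thesis
      unfolding eq using digit_value_Suc_eq_iff[of "vdc_digit b n" q k c] vdc_digit_less[OF deg] R(2)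
      by (auto simp: q_def)
  qed
  ultimately show ?case by blast
qed simp

text \<open>A piece \<open>(k, c)\<close> of the decomposition fixes the first \<open>M - k\<close>
  digits, hence a residue modulo \<open>b^(M - k)\<close>, and the density of that class is the
  length of the piece. The indicators are real so that they can be multiplied out over the
  coordinates.\<close>

lemma vdc_grid_interval:
  fixes b :: "'p::prime_card mod_ring poly"
  assumes deg: "degree b \<ge> 1"
  defines "q \<equiv> CARD('p) ^ degree b"
  assumes "l \<le> u" "u \<le> q ^ M"
  shows "\<exists>(F :: (nat \<times> nat) set) m R. finite F \<and> card F \<le> 2 * q * (M + 1) \<and>
    (\<forall>n. of_bool (l \<le> digit_value q (vdc_digit b n) M \<and> digit_value q (vdc_digit b n) M < u)
       = (\<Sum>x\<in>F. of_bool (b ^ m x dvd digit_poly n - R x) :: real)) \<and>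
    (\<Sum>x\<in>F. 1 / real (CARD('p) ^ degree (b ^ m x))) = (real u - real l) / real (q ^ M)"
proof -
  have b0: "b \<noteq> 0" using deg by auto
  have "1 < CARD('p) ^ 1"
    using CARD_prime_gt_1[where 'p = 'p] by simp
  also have "\<dots> \<le> q"
    unfolding q_def using deg CARD_prime_gt_1[where 'p = 'p] by (intro power_increasing) auto
  finally have q1: "q > 1" .
  obtain F :: "(nat \<times> nat) set" where F: "finite F" "card F \<le> 2 * q * (M + 1)" "\<forall>(k, c)\<in>F. k \<le> M"
    "\<And>x. of_bool (l \<le> x \<and> x < u) = (\<Sum>(k, c)\<in>F. of_bool (x div q ^ k = c) :: nat)"
    "(\<Sum>(k, c)\<in>F. q ^ k) = u - l"
    using q_adic_decomposition[OF q1 assms(3,4)] by blast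
  \<comment> \<open>The left end \<open>c * q^k\<close> of a piece is covered, so it lies below
    \<open>u <= q^M\<close>; this bounds \<open>c\<close> as a number of \<open>M - k\<close>
    digits.\<close>
  have c_less: "snd x < q ^ (M - fst x)" if "x \<in> F" for x
  proof -
    let ?y = "snd x * q ^ fst x"
    have "(1::nat) \<le> (\<Sum>(k, c)\<in>F. of_bool (?y div q ^ k = c))"
      using member_le_sum[OF that, of "\<lambda>(k, c). of_bool (?y div q ^ k = c) :: nat"] F(1) q1
      by (auto simp: case_prod_unfold)
    then have "?y < u"
      using F(4)[of ?y] by (cases "l \<le> ?y \<and> ?y < u") auto
    also have "\<dots> \<le> q ^ (M - fst x) * q ^ fst x"
      using assms(4) F(3) that by (auto simp flip: power_add)
    finally show ?thesis by simp
  qed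
  have "\<forall>x\<in>F. \<exists>R. \<forall>n. digit_value q (vdc_digit b n) (M - fst x) = snd x
      \<longleftrightarrow> b ^ (M - fst x) dvd digit_poly n - R"
  proof
    fix x assume "x \<in> F"
    obtain R where R: "R mod b ^ (M - fst x) = R"
      "\<And>n. digit_value q (vdc_digit b n) (M - fst x) = snd x \<longleftrightarrow> digit_poly n mod b ^ (M - fst x) = R"
      using digit_value_vdc_eq_iff[OF deg c_less[OF \<open>x \<in> F\<close>, unfolded q_def], folded q_def] by blast
    have "digit_poly n mod b ^ (M - fst x) = R \<longleftrightarrow> b ^ (M - fst x) dvd digit_poly n - R" for n
      using R(1) mod_eq_dvd_iff[of "digit_poly n" "b ^ (M - fst x)" R] by simp
    with R(2) show "\<exists>R. \<forall>n. digit_value q (vdc_digit b n) (M - fst x) = snd x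
      \<longleftrightarrow> b ^ (M - fst x) dvd digit_poly n - R"
      by (intro exI[of _ R]) blast
  qed
  then obtain R where R: "\<And>x n. x \<in> F \<Longrightarrow> digit_value q (vdc_digit b n) (M - fst x) = snd x
      \<longleftrightarrow> b ^ (M - fst x) dvd digit_poly n - R x"
    by metis
  have "of_bool (l \<le> digit_value q (vdc_digit b n) M \<and> digit_value q (vdc_digit b n) M < u)
       = (\<Sum>x\<in>F. of_bool (b ^ (M - fst x) dvd digit_poly n - R x) :: real)" for n
  proof -
    have "digit_value q (vdc_digit b n) M div q ^ fst x = digit_value q (vdc_digit b n) (M - fst x)"
      if "x \<in> F" for x
    proof -
      have "fst x \<le> M" using F(3) that by auto
      then show ?thesis
        using digit_value_div[of "vdc_digit b n" q "M - fst x" M] vdc_digit_less[OF deg] by (simp add: q_def)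
    qed
    then have "(\<Sum>(k, c)\<in>F. of_bool (digit_value q (vdc_digit b n) M div q ^ k = c) :: nat)
        = (\<Sum>x\<in>F. of_bool (b ^ (M - fst x) dvd digit_poly n - R x))"
      unfolding case_prod_unfold by (intro sum.cong refl) (simp add: R)
    then have "of_bool (l \<le> digit_value q (vdc_digit b n) M \<and> digit_value q (vdc_digit b n) M < u)
        = (\<Sum>x\<in>F. of_bool (b ^ (M - fst x) dvd digit_poly n - R x) :: nat)"
      by (simp only: F(4))
    then have "real (of_bool (l \<le> digit_value q (vdc_digit b n) M \<and> digit_value q (vdc_digit b n) M < u))
        = real (\<Sum>x\<in>F. of_bool (b ^ (M - fst x) dvd digit_poly n - R x))"
      by (rule arg_cong)
    then show ?thesis
      by (simp only: of_nat_sum of_nat_of_bool)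
  qed
  moreover have "(\<Sum>x\<in>F. 1 / real (CARD('p) ^ degree (b ^ (M - fst x)))) = (real u - real l) / real (q ^ M)"
  proof -
    have "1 / real (CARD('p) ^ degree (b ^ (M - fst x))) = real (q ^ fst x) / real (q ^ M)" if "x \<in> F" for x
    proof -
      have "fst x \<le> M" using F(3) that by auto
      moreover have "CARD('p) ^ degree (b ^ (M - fst x)) = q ^ (M - fst x)"
        using b0 by (simp add: degree_power_eq q_def power_mult mult.commute)
      moreover have "q ^ M = q ^ (M - fst x) * q ^ fst x"
        using \<open>fst x \<le> M\<close> by (simp flip: power_add)
      ultimately show ?thesis
        using q1 by simp
    qed
    then have "(\<Sum>x\<in>F. 1 / real (CARD('p) ^ degree (b ^ (M - fst x))))
        = real (\<Sum>x\<in>F. q ^ fst x) / real (q ^ M)"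
      by (simp add: sum_divide_distrib)
    also have "(\<Sum>x\<in>F. q ^ fst x) = u - l"
      using F(5) by (simp add: case_prod_unfold)
    finally show ?thesis
      using assms(3) by (simp add: of_nat_diff)
  qed
  ultimately show ?thesis
    using F(1,2) by (intro exI[of _ F] exI[of _ "\<lambda>x. M - fst x"] exI[of _ R] conjI allI)
qed

lemma chinese_remainder_dvd:
  fixes g r :: "nat \<Rightarrow> 'a::field_gcd poly"
  assumes "\<And>i j. i < t \<Longrightarrow> j < t \<Longrightarrow> i \<noteq> j \<Longrightarrow> coprime (g i) (g j)"
  shows "\<exists>R. \<forall>P. (\<forall>j<t. g j dvd P - r j) \<longleftrightarrow> (\<Prod>j<t. g j) dvd P - R"
  using assms
proof (induction t)
  case (Suc t)
  define G where "G = (\<Prod>j<t. g j)"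
  obtain R where R: "\<And>P. (\<forall>j<t. g j dvd P - r j) \<longleftrightarrow> G dvd P - R"
    using Suc unfolding G_def by (metis less_Suc_eq)
  have cop: "coprime G (g t)"
    unfolding G_def by (rule prod_coprime_left) (use Suc.prems in auto)
  obtain x y where xy: "x * G + y * g t = 1"
    using bezout_coefficients_fst_snd[of G "g t"] cop by (metis coprime_imp_gcd_eq_1)
  \<comment> \<open>Congruent to \<open>R\<close> modulo \<open>G\<close>, and to \<open>r t\<close>
    modulo \<open>g t\<close> because \<open>x * G\<close> is 1 there.\<close>
  define S where "S = R + x * G * (r t - R)"
  have "y * g t = 1 - x * G"
    using xy by (simp add: algebra_simps)
  then have "r t - S = (r t - R) * (y * g t)"
    by (simp only: S_def) (simp add: algebra_simps)
  then have dvds: "g t dvd r t - S" "G dvd R - S"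
    by (simp_all add: S_def)
  have "G dvd P - S \<longleftrightarrow> G dvd P - R" for P
    using dvd_add_right_iff[OF dvds(2), of "P - R"] by simp
  moreover have "g t dvd P - S \<longleftrightarrow> g t dvd P - r t" for P
    using dvd_add_right_iff[OF dvds(1), of "P - r t"] by simp
  ultimately have "(\<forall>j<Suc t. g j dvd P - r j) \<longleftrightarrow> G * g t dvd P - S" for P
    using cop by (simp only: All_less_Suc R) (auto dest: dvd_mult_left dvd_mult_right intro: divides_mult)
  then show ?case
    by (auto simp: G_def)
qed auto

section \<open>Boxes\<close>

text \<open>The product over the coordinates of the indicator sums expands into a sum over choices
  \<open>f\<close> of one piece per coordinate, and each choice is a single residue class modulo
  \<open>B f\<close>. The number of choices supplies the power \<open>t\<close> of
  \<open>M + 1\<close>, each class one more.\<close>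

lemma kronecker_halton_grid_box:
  fixes b :: "nat \<Rightarrow> 'p::prime_card mod_ring poly" and L :: "'p mod_ring fls"
  assumes bad: "\<And>Q. Q \<noteq> 0 \<Longrightarrow> \<exists>l < degree Q + K. frac_coeff L Q l \<noteq> 0"
  assumes deg: "\<And>j. j < t \<Longrightarrow> degree (b j) \<ge> 1"
    and cop: "\<And>i j. i < t \<Longrightarrow> j < t \<Longrightarrow> i \<noteq> j \<Longrightarrow> coprime (b i) (b j)"
    and uv: "0 \<le> u" "u \<le> v" "v \<le> 1"
    and N: "N \<ge> 1" "N \<le> CARD('p) ^ M"
  defines "q \<equiv> \<lambda>j. CARD('p) ^ degree (b j)"
  assumes lr: "\<And>j. j < t \<Longrightarrow> l j \<le> r j" "\<And>j. j < t \<Longrightarrow> r j \<le> q j ^ M"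
  shows "\<bar>real (card {n. n < N \<and> (u \<le> kronecker_seq L n \<and> kronecker_seq L n < v) \<and>
        (\<forall>j<t. l j \<le> digit_value (q j) (vdc_digit (b j) n) M \<and> digit_value (q j) (vdc_digit (b j) n) M < r j)})
      - real N * ((v - u) * (\<Prod>j<t. (real (r j) - real (l j)) / real (q j ^ M)))\<bar>
    \<le> (\<Prod>j<t. 2 * real (q j)) * (8 * real (CARD('p) ^ (K + 1))) * real (M + 1) ^ (t + 1) * sqrt (real N)"
proof -
  let ?p = "CARD('p)"
  define A where "A = {n. n < N \<and> u \<le> kronecker_seq L n \<and> kronecker_seq L n < v}"
  define I where "I n j \<longleftrightarrow> l j \<le> digit_value (q j) (vdc_digit (b j) n) M \<and> digit_value (q j) (vdc_digit (b j) n) M < r j" for n j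
  have finA: "finite A" by (simp add: A_def)
  define good where "good j F m R \<longleftrightarrow> finite F \<and> card F \<le> 2 * q j * (M + 1) \<and>
    (\<forall>n. of_bool (I n j) = (\<Sum>x\<in>F. of_bool (b j ^ m x dvd digit_poly n - R x) :: real)) \<and>
    (\<Sum>x\<in>F. 1 / real (?p ^ degree (b j ^ m x))) = (real (r j) - real (l j)) / real (q j ^ M)"
    for j and F :: "(nat \<times> nat) set" and m :: "nat \<times> nat \<Rightarrow> nat" and R :: "nat \<times> nat \<Rightarrow> 'p mod_ring poly"
  have "\<forall>j. \<exists>F m R. j < t \<longrightarrow> good j F m R"
    unfolding good_def I_def q_def using vdc_grid_interval[OF deg lr[unfolded q_def]] by blast
  then obtain F m R where good: "\<And>j. j < t \<Longrightarrow> good j (F j) (m j) (R j)"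
    by metis
  then have F: "\<And>j. j < t \<Longrightarrow> finite (F j)" "\<And>j. j < t \<Longrightarrow> card (F j) \<le> 2 * q j * (M + 1)"
    "\<And>j n. j < t \<Longrightarrow> of_bool (I n j) = (\<Sum>x\<in>F j. of_bool (b j ^ m j x dvd digit_poly n - R j x) :: real)"
    "\<And>j. j < t \<Longrightarrow> (\<Sum>x\<in>F j. 1 / real (?p ^ degree (b j ^ m j x))) = (real (r j) - real (l j)) / real (q j ^ M)"
    unfolding good_def by blast+
  define \<Phi> where "\<Phi> = PiE {..<t} F"
  define B where "B f = (\<Prod>j<t. b j ^ m j (f j))" for f
  have bnz: "b j \<noteq> 0" if "j < t" for j
    using deg[OF that] by auto
  have B0: "B f \<noteq> 0" for f
    using bnz by (simp add: B_def)
  have "\<forall>f. \<exists>S. \<forall>P. (\<forall>j<t. b j ^ m j (f j) dvd P - R j (f j)) \<longleftrightarrow> B f dvd P - S"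
    unfolding B_def by (intro allI chinese_remainder_dvd) (simp add: cop)
  then obtain S where S: "\<And>f P. (\<forall>j<t. b j ^ m j (f j) dvd P - R j (f j)) \<longleftrightarrow> B f dvd P - S f"
    by metis
  have fin\<Phi>: "finite \<Phi>"
    unfolding \<Phi>_def using F(1) by (intro finite_PiE) auto
  have card\<Phi>: "real (card \<Phi>) \<le> (\<Prod>j<t. 2 * real (q j)) * real (M + 1) ^ t"
  proof -
    have "real (card \<Phi>) = (\<Prod>j<t. real (card (F j)))"
      by (simp add: \<Phi>_def card_PiE)
    also have "\<dots> \<le> (\<Prod>j<t. 2 * real (q j) * real (M + 1))"
    proof (intro prod_mono conjI)
      fix j assume "j \<in> {..<t}"
      then show "real (card (F j)) \<le> 2 * real (q j) * real (M + 1)"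
        using of_nat_mono[OF F(2)[of j], where 'a = real] by (simp only: of_nat_mult of_nat_numeral lessThan_iff)
    qed simp
    also have "\<dots> = (\<Prod>j<t. 2 * real (q j)) * real (M + 1) ^ t"
      by (simp only: prod.distrib prod_constant card_lessThan)
    finally show ?thesis .
  qed
  have count: "real (card {n \<in> A. \<forall>j<t. I n j}) = (\<Sum>f\<in>\<Phi>. real (card {n \<in> A. B f dvd digit_poly n - S f}))"
  proof -
    have "real (card {n \<in> A. \<forall>j<t. I n j}) = (\<Sum>n\<in>A. of_bool (\<forall>j<t. I n j))"
      using finA by (simp add: sum_of_bool_eq Int_def)
    also have "\<dots> = (\<Sum>n\<in>A. \<Sum>f\<in>\<Phi>. of_bool (B f dvd digit_poly n - S f))"
    proof (intro sum.cong refl)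
      fix n
      have "(of_bool (\<forall>j<t. I n j) :: real) = (\<Prod>j<t. of_bool (I n j))"
        by (induction t) (auto simp: less_Suc_eq)
      also have "\<dots> = (\<Prod>j<t. \<Sum>x\<in>F j. of_bool (b j ^ m j x dvd digit_poly n - R j x))"
        by (intro prod.cong refl F(3)) auto
      also have "\<dots> = (\<Sum>f\<in>\<Phi>. \<Prod>j<t. of_bool (b j ^ m j (f j) dvd digit_poly n - R j (f j)))"
        unfolding \<Phi>_def using F(1) by (intro prod_sum_PiE) auto
      also have "\<dots> = (\<Sum>f\<in>\<Phi>. of_bool (\<forall>j<t. b j ^ m j (f j) dvd digit_poly n - R j (f j)))"
        by (intro sum.cong refl, induction t) (auto simp: less_Suc_eq)
      finally show "(of_bool (\<forall>j<t. I n j) :: real) = (\<Sum>f\<in>\<Phi>. of_bool (B f dvd digit_poly n - S f))"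
        by (simp only: S)
    qed
    also have "\<dots> = (\<Sum>f\<in>\<Phi>. \<Sum>n\<in>A. of_bool (B f dvd digit_poly n - S f))"
      by (rule sum.swap)
    also have "\<dots> = (\<Sum>f\<in>\<Phi>. real (card {n \<in> A. B f dvd digit_poly n - S f}))"
      using finA by (simp add: sum_of_bool_eq Int_def)
    finally show ?thesis .
  qed
  \<comment> \<open>The same expansion of the side lengths yields the class densities, so the main
    terms match class by class and only errors remain.\<close>
  have vol: "(\<Prod>j<t. (real (r j) - real (l j)) / real (q j ^ M)) = (\<Sum>f\<in>\<Phi>. 1 / real (?p ^ degree (B f)))"
  proof -
    have "(\<Prod>j<t. (real (r j) - real (l j)) / real (q j ^ M))
        = (\<Prod>j<t. \<Sum>x\<in>F j. 1 / real (?p ^ degree (b j ^ m j x)))"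
      by (intro prod.cong refl F(4)[symmetric]) auto
    also have "\<dots> = (\<Sum>f\<in>\<Phi>. \<Prod>j<t. 1 / real (?p ^ degree (b j ^ m j (f j))))"
      unfolding \<Phi>_def using F(1) by (intro prod_sum_PiE) auto
    also have "\<dots> = (\<Sum>f\<in>\<Phi>. 1 / real (?p ^ degree (B f)))"
    proof (intro sum.cong refl)
      fix f
      have "degree (B f) = (\<Sum>j<t. degree (b j ^ m j (f j)))"
        unfolding B_def using bnz by (intro degree_prod_eq_sum_degree) auto
      then show "(\<Prod>j<t. 1 / real (?p ^ degree (b j ^ m j (f j)))) = 1 / real (?p ^ degree (B f))"
        by (simp only: power_sum of_nat_prod prod_dividef prod.neutral_const)
    qed
    finally show ?thesis .
  qed
  let ?E = "8 * real (?p ^ (K + 1)) * real (M + 1) * sqrt (real N)"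
  have "\<bar>real (card {n \<in> A. \<forall>j<t. I n j}) - real N * ((v - u) * (\<Sum>f\<in>\<Phi>. 1 / real (?p ^ degree (B f))))\<bar>
      = \<bar>\<Sum>f\<in>\<Phi>. real (card {n \<in> A. B f dvd digit_poly n - S f}) - real N * (v - u) / real (?p ^ degree (B f))\<bar>"
    unfolding count by (simp add: sum_subtractf sum_distrib_left mult.assoc)
  also have "\<dots> \<le> (\<Sum>f\<in>\<Phi>. ?E)"
  proof (intro order.trans[OF sum_abs] sum_mono)
    fix f
    have class_eq: "{n \<in> A. B f dvd digit_poly n - S f} = {n. n < N \<and> B f dvd digit_poly n - S f \<and>
        u \<le> kronecker_seq L n \<and> kronecker_seq L n < v}"
      by (auto simp: A_def)
    show "\<bar>real (card {n \<in> A. B f dvd digit_poly n - S f}) - real N * (v - u) / real (?p ^ degree (B f))\<bar> \<le> ?E"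
      unfolding class_eq by (rule kronecker_residue_class_discrepancy[OF bad B0 uv N])
  qed
  also have "\<dots> = real (card \<Phi>) * ?E"
    by simp
  also have "\<dots> \<le> ((\<Prod>j<t. 2 * real (q j)) * real (M + 1) ^ t) * ?E"
    using card\<Phi> by (intro mult_right_mono) auto
  also have "\<dots> = (\<Prod>j<t. 2 * real (q j)) * (8 * real (?p ^ (K + 1))) * real (M + 1) ^ (t + 1) * sqrt (real N)"
    by (simp only: power_add power_one_right mult_ac)
  finally show ?thesis
    unfolding vol by (simp only: A_def I_def mem_Collect_eq conj_assoc)
qed

lemma norm_diff_divide_le_1:
  fixes a b Q :: real
  shows "0 < Q \<Longrightarrow> a \<le> b \<Longrightarrow> 0 \<le> a \<Longrightarrow> b \<le> Q \<Longrightarrow> norm ((b - a) / Q) \<le> 1"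
  by (simp add: divide_le_eq)

lemma kronecker_halton_box:
  fixes b :: "nat \<Rightarrow> 'p::prime_card mod_ring poly" and L :: "'p mod_ring fls"
  assumes bad: "\<And>Q. Q \<noteq> 0 \<Longrightarrow> \<exists>l < degree Q + K. frac_coeff L Q l \<noteq> 0"
  assumes deg: "\<And>j. j < t \<Longrightarrow> degree (b j) \<ge> 1"
    and cop: "\<And>i j. i < t \<Longrightarrow> j < t \<Longrightarrow> i \<noteq> j \<Longrightarrow> coprime (b i) (b j)"
    and uv: "0 \<le> u" "u \<le> v" "v \<le> 1"
    and N: "N \<ge> 1" "N \<le> CARD('p) ^ M"
    and xy: "\<And>j. j < t \<Longrightarrow> 0 \<le> x j \<and> x j \<le> y j \<and> y j \<le> 1"
  defines "C \<equiv> (\<Prod>j<t. 2 * real (CARD('p) ^ degree (b j))) * (8 * real (CARD('p) ^ (K + 1))) + 3 * real t"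
  shows "\<bar>real (card {n. n < N \<and> (u \<le> kronecker_seq L n \<and> kronecker_seq L n < v) \<and>
        (\<forall>j<t. x j \<le> vdc_seq (b j) n \<and> vdc_seq (b j) n < y j)})
      - real N * ((v - u) * (\<Prod>j<t. y j - x j))\<bar>
    \<le> C * real (M + 1) ^ (t + 1) * sqrt (real N)"
proof -
  define q where "q j = CARD('p) ^ degree (b j)" for j
  define V where "V j n = digit_value (q j) (vdc_digit (b j) n) M" for j n
  define T where "T = (\<Prod>j<t. 2 * real (q j)) * (8 * real (CARD('p) ^ (K + 1))) * real (M + 1) ^ (t + 1) * sqrt (real N)"
  define G where "G l r = {n. n < N \<and> (u \<le> kronecker_seq L n \<and> kronecker_seq L n < v) \<and>
      (\<forall>j<t. l j \<le> V j n \<and> V j n < r j)}" for l r :: "nat \<Rightarrow> nat"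
  define A where "A = {n. n < N \<and> (u \<le> kronecker_seq L n \<and> kronecker_seq L n < v) \<and>
        (\<forall>j<t. x j \<le> vdc_seq (b j) n \<and> vdc_seq (b j) n < y j)}"
  have bounds: "real (V j n) \<le> vdc_seq (b j) n * real (q j ^ M)"
    "vdc_seq (b j) n * real (q j ^ M) \<le> real (V j n) + 1" if "j < t" for j n
    unfolding V_def q_def by (rule vdc_seq_bounds[OF deg[OF that]])+
  have p1: "CARD('p) > 1" by (rule CARD_prime_gt_1)
  have q_pos: "q j ^ M > 0" for j
    using p1 by (simp add: q_def)
  \<comment> \<open>The mesh is at most \<open>1 / N\<close>, so rounding one axis by 3 cells
    changes \<open>N\<close> times the volume by at most 3; hence \<open>3 * real t\<close> in
    \<open>C\<close>.\<close>
  have q_ge: "N \<le> q j ^ M" if "j < t" for j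
  proof -
    have "CARD('p) ^ 1 \<le> q j"
      unfolding q_def using p1 deg[OF that] by (intro power_increasing) auto
    then have "CARD('p) ^ M \<le> q j ^ M"
      by (intro power_mono) auto
    with N show ?thesis by linarith
  qed
  have grid: "\<bar>real (card (G l r)) - real N * ((v - u) * (\<Prod>j<t. y j - x j))\<bar> \<le> T + 3 * real t"
    if lr: "\<And>j. j < t \<Longrightarrow> l j \<le> r j" "\<And>j. j < t \<Longrightarrow> r j \<le> q j ^ M"
      "\<And>j. j < t \<Longrightarrow> \<bar>real (r j) - real (l j) - (y j - x j) * real (q j ^ M)\<bar> \<le> 3" for l r
  proof -
    let ?z = "\<lambda>j. (real (r j) - real (l j)) / real (q j ^ M)"
    have 1: "\<bar>real (card (G l r)) - real N * ((v - u) * (\<Prod>j<t. ?z j))\<bar> \<le> T"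
      unfolding G_def T_def V_def q_def
      by (rule kronecker_halton_grid_box[OF bad deg cop uv N lr(1) lr(2)[unfolded q_def]])
    \<comment> \<open>All factors have absolute value at most 1, so replacing them one at a time
      costs at most the sum of the individual changes.\<close>
    have "norm ((\<Prod>j<t. ?z j) - (\<Prod>j<t. y j - x j)) \<le> (\<Sum>j<t. norm (?z j - (y j - x j)))"
    proof (rule norm_prod_diff)
      fix j assume j: "j \<in> {..<t}"
      have "real (q j ^ M) > 0" using q_pos[of j] by (simp only: of_nat_0_less_iff)
      moreover have "real (r j) \<le> real (q j ^ M)" "real (l j) \<le> real (r j)"
        using lr(1,2)[of j] j by (simp_all only: of_nat_le_iff lessThan_iff)
      ultimately show "norm (?z j) \<le> 1"
        by (intro norm_diff_divide_le_1) auto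
      show "norm (y j - x j) \<le> 1"
        using xy[of j] j by auto
    qed
    also have "\<dots> \<le> (\<Sum>j<t. 3 / real N)"
    proof (rule sum_mono)
      fix j assume j: "j \<in> {..<t}"
      have Q: "real (q j ^ M) > 0" using q_pos[of j] by (simp only: of_nat_0_less_iff)
      have "real N \<le> real (q j ^ M)"
        using q_ge[of j] j by (simp only: of_nat_le_iff lessThan_iff)
      have "?z j - (y j - x j) = (real (r j) - real (l j) - (y j - x j) * real (q j ^ M)) / real (q j ^ M)"
        using Q by (simp add: diff_divide_distrib)
      then have "norm (?z j - (y j - x j)) = \<bar>real (r j) - real (l j) - (y j - x j) * real (q j ^ M)\<bar> / real (q j ^ M)"
        using Q by (simp add: abs_divide)
      also have "\<dots> \<le> 3 / real N"
        using lr(3)[of j] j N \<open>real N \<le> real (q j ^ M)\<close> by (intro frac_le) auto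
      finally show "norm (?z j - (y j - x j)) \<le> 3 / real N" .
    qed
    finally have 2: "\<bar>(\<Prod>j<t. ?z j) - (\<Prod>j<t. y j - x j)\<bar> \<le> 3 * real t / real N"
      by (simp add: mult.commute)
    have "\<bar>real N * ((v - u) * (\<Prod>j<t. ?z j)) - real N * ((v - u) * (\<Prod>j<t. y j - x j))\<bar>
        = real N * ((v - u) * \<bar>(\<Prod>j<t. ?z j) - (\<Prod>j<t. y j - x j)\<bar>)"
      using uv by (simp add: abs_mult flip: right_diff_distrib)
    also have "\<dots> \<le> real N * (1 * (3 * real t / real N))"
      using 2 uv by (intro mult_left_mono mult_mono) auto
    also have "\<dots> = 3 * real t"
      using N by simp
    finally show ?thesis
      using 1 by linarith
  qed
  define approx where "approx j l r \<longleftrightarrow> l \<le> r \<and> r \<le> q j ^ M \<and>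
    \<bar>real r - real l - (y j - x j) * real (q j ^ M)\<bar> \<le> 3" for j l r
  define inside where "inside j l r \<longleftrightarrow> (\<forall>V z. real V \<le> z * real (q j ^ M) \<longrightarrow> z * real (q j ^ M) \<le> real V + 1 \<longrightarrow>
    l \<le> V \<longrightarrow> V < r \<longrightarrow> x j \<le> z \<and> z < y j)" for j l r
  define outside where "outside j l r \<longleftrightarrow> (\<forall>V z. real V \<le> z * real (q j ^ M) \<longrightarrow> z * real (q j ^ M) \<le> real V + 1 \<longrightarrow>
    x j \<le> z \<longrightarrow> z < y j \<longrightarrow> q j ^ M > 0 \<longrightarrow> l \<le> V \<and> V < r)" for j l r
  have "\<exists>l r. approx j l r \<and> inside j l r" if "j < t" for j
    using inner_grid_interval[of "x j" "y j" "q j ^ M"] xy[OF that]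
    unfolding approx_def inside_def by (simp only: conj_assoc)
  then obtain l r where inner: "\<And>j. j < t \<Longrightarrow> approx j (l j) (r j) \<and> inside j (l j) (r j)"
    by metis
  have "\<exists>l r. approx j l r \<and> outside j l r" if "j < t" for j
    using outer_grid_interval[of "x j" "y j" "q j ^ M"] xy[OF that]
    unfolding approx_def outside_def by (simp only: conj_assoc)
  then obtain l' r' where outer: "\<And>j. j < t \<Longrightarrow> approx j (l' j) (r' j) \<and> outside j (l' j) (r' j)"
    by metis
  have inner_error: "\<bar>real (card (G l r)) - real N * ((v - u) * (\<Prod>j<t. y j - x j))\<bar> \<le> T + 3 * real t"
    by (rule grid) (use inner in \<open>auto simp: approx_def\<close>)
  have outer_error: "\<bar>real (card (G l' r')) - real N * ((v - u) * (\<Prod>j<t. y j - x j))\<bar> \<le> T + 3 * real t"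
    by (rule grid) (use outer in \<open>auto simp: approx_def\<close>)
  have "G l r \<subseteq> A"
  proof
    fix n assume n: "n \<in> G l r"
    have "x j \<le> vdc_seq (b j) n \<and> vdc_seq (b j) n < y j" if "j < t" for j
    proof -
      have "l j \<le> V j n" "V j n < r j"
        using n that by (auto simp: G_def)
      then show ?thesis
        using inner[OF that] bounds[OF that, of n] unfolding inside_def by blast
    qed
    with n show "n \<in> A"
      by (simp add: A_def G_def)
  qed
  then have "card (G l r) \<le> card A"
    by (intro card_mono) (auto simp: A_def)
  moreover have "A \<subseteq> G l' r'"
  proof
    fix n assume n: "n \<in> A"
    have "l' j \<le> V j n \<and> V j n < r' j" if "j < t" for j
    proof -
      have "x j \<le> vdc_seq (b j) n" "vdc_seq (b j) n < y j" "q j ^ M > 0"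
        using n that q_pos[of j] by (auto simp: A_def)
      then show ?thesis
        using outer[OF that] bounds[OF that, of n] unfolding outside_def by blast
    qed
    with n show "n \<in> G l' r'"
      by (simp add: A_def G_def)
  qed
  then have "card A \<le> card (G l' r')"
    by (intro card_mono) (auto simp: G_def)
  ultimately have "\<bar>real (card A) - real N * ((v - u) * (\<Prod>j<t. y j - x j))\<bar> \<le> T + 3 * real t"
    using inner_error outer_error by linarith
  also have "3 * real t \<le> 3 * real t * real (M + 1) ^ (t + 1) * sqrt (real N)"
  proof -
    have "1 \<le> real (M + 1) ^ (t + 1)" by (rule one_le_power) simp
    moreover have "1 \<le> sqrt (real N)" using N by simp
    ultimately have "1 * 1 \<le> real (M + 1) ^ (t + 1) * sqrt (real N)"
      by (intro mult_mono) auto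
    then have "3 * real t * 1 \<le> 3 * real t * (real (M + 1) ^ (t + 1) * sqrt (real N))"
      by (intro mult_left_mono) auto
    then show ?thesis by (simp only: mult.assoc mult_1_right)
  qed
  finally show ?thesis
    unfolding A_def[symmetric] by (simp only: C_def T_def q_def distrib_right add_left_mono)
qed

text \<open>The ceiling of \<open>log 2 N\<close>, increased by 1, is at most
  \<open>log 2 N + 2\<close>, hence at most \<open>3 * log 2 N\<close> because
  \<open>N >= 2\<close>. Base 2 is enough since \<open>p >= 2\<close>.\<close>

lemma exists_logarithmic_exponent:
  assumes "N \<ge> 2" "p \<ge> 2"
  shows "\<exists>M. N \<le> p ^ M \<and> real (M + 1) \<le> 3 / ln 2 * ln (real N)"
proof -
  define M where "M = nat \<lceil>log 2 (real N)\<rceil>"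
  have l1: "1 \<le> log 2 (real N)"
    using assms by (simp add: le_log_iff)
  have "real N = 2 powr (log 2 (real N))"
    using assms by simp
  also have "\<dots> \<le> 2 powr (real M)"
    using l1 unfolding M_def by (intro powr_mono) linarith+
  also have "\<dots> = real (2 ^ M)"
    by (simp add: powr_realpow)
  finally have "N \<le> 2 ^ M"
    by (simp only: of_nat_le_iff)
  also have "\<dots> \<le> p ^ M"
    using assms by (intro power_mono) auto
  finally have "N \<le> p ^ M" .
  moreover have "real (M + 1) \<le> 3 * log 2 (real N)"
    using l1 unfolding M_def by linarith
  ultimately show ?thesis
    by (auto simp: log_def)
qed

theorem theorem2:
  fixes L :: "'p::prime_card mod_ring fls"
    and t :: nat
    and b :: "nat \<Rightarrow> 'p mod_ring poly"
  assumes monic: "\<forall>k<t. monic (b k)"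
    and nonconst: "\<forall>k<t. degree (b k) \<ge> 1"
    and coprime: "\<forall>k<t. \<forall>l<t. k \<noteq> l \<longrightarrow> coprime (b k) (b l)"
    and irrat: "irrational_fls L"
    and bounded: "\<exists>K. \<forall>i\<ge>1. degree (partial_quotient L i) \<le> K"
  shows "\<exists>c>0. \<forall>N::nat\<ge>2.
           real N * discrepancy (Suc t) (kron_halton L b) N
             \<le> c * sqrt (real N) * ln (real N) ^ (t + 1)"
proof -
  obtain K where K: "\<And>i. i \<ge> 1 \<Longrightarrow> degree (partial_quotient L i) \<le> K"
    using bounded by blast
  have bad: "\<exists>l < degree Q + K. frac_coeff L Q l \<noteq> 0" if "Q \<noteq> 0" for Q
    unfolding frac_coeff_def using badly_approximable[OF irrat K that] by simp
  define C where "C = (\<Prod>j<t. 2 * real (CARD('p) ^ degree (b j))) * (8 * real (CARD('p) ^ (K + 1))) + 3 * real t"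
  have C: "C > 0"
    unfolding C_def by (intro add_pos_nonneg mult_pos_pos prod_pos) auto
  define c where "c = C * (3 / ln 2) ^ (t + 1)"
  have "c > 0"
    unfolding c_def using C by (intro mult_pos_pos zero_less_power) auto
  moreover have "real N * discrepancy (Suc t) (kron_halton L b) N \<le> c * sqrt (real N) * ln (real N) ^ (t + 1)"
    if N: "N \<ge> 2" for N
  proof -
    obtain M where M: "N \<le> CARD('p) ^ M" "real (M + 1) \<le> 3 / ln 2 * ln (real N)"
      using exists_logarithmic_exponent[OF N, of "CARD('p)"] CARD_prime_gt_1[where 'p = 'p] by auto
    define X where "X = c * sqrt (real N) * ln (real N) ^ (t + 1)"
    have N1: "N \<ge> 1" using N by simp
    have box: "\<bar>real (card {n. n < N \<and> (\<forall>j<Suc t. u j \<le> kron_halton L b n j \<and> kron_halton L b n j < v j)}) / real N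
        - (\<Prod>j<Suc t. v j - u j)\<bar> \<le> X / real N"
      if uv: "\<forall>j<Suc t. 0 \<le> u j \<and> u j \<le> v j \<and> v j \<le> 1" for u v
    proof -
      have set_eq: "{n. n < N \<and> (\<forall>j<Suc t. u j \<le> kron_halton L b n j \<and> kron_halton L b n j < v j)}
        = {n. n < N \<and> (u 0 \<le> kronecker_seq L n \<and> kronecker_seq L n < v 0) \<and>
          (\<forall>j<t. u (Suc j) \<le> vdc_seq (b j) n \<and> vdc_seq (b j) n < v (Suc j))}"
        by (simp add: All_less_Suc2 kron_halton_def)
      have "\<bar>real (card {n. n < N \<and> (u 0 \<le> kronecker_seq L n \<and> kronecker_seq L n < v 0) \<and>
          (\<forall>j<t. u (Suc j) \<le> vdc_seq (b j) n \<and> vdc_seq (b j) n < v (Suc j))})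
        - real N * ((v 0 - u 0) * (\<Prod>j<t. v (Suc j) - u (Suc j)))\<bar>
        \<le> C * real (M + 1) ^ (t + 1) * sqrt (real N)"
        unfolding C_def
        by (rule kronecker_halton_box[OF bad]) (use nonconst coprime uv N1 M(1) in auto)
      also have "\<dots> \<le> C * (3 / ln 2 * ln (real N)) ^ (t + 1) * sqrt (real N)"
        using M(2) C by (intro mult_right_mono mult_left_mono power_mono) auto
      also have "\<dots> = X"
        by (simp only: X_def c_def power_mult_distrib mult_ac)
      finally show ?thesis
        unfolding set_eq prod.lessThan_Suc_shift using N1
        by (simp add: divide_le_eq pos_le_divide_eq abs_le_iff field_simps)
    qed
    have "discrepancy (Suc t) (kron_halton L b) N \<le> X / real N"
      unfolding discrepancy_def
    proof (rule cSup_least)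
      let ?D = "{(u, v). \<forall>j<Suc t. 0 \<le> u j \<and> u j \<le> v j \<and> v j \<le> (1::real)}"
      let ?f = "\<lambda>(u, v). \<bar>real (card {n. n < N \<and> (\<forall>j<Suc t. u j \<le> kron_halton L b n j \<and> kron_halton L b n j < v j)}) / real N
          - (\<Prod>j<Suc t. v j - u j)\<bar>"
      \<comment> \<open>The degenerate box at the origin makes the set nonempty, as bounding the
        conditionally complete supremum requires.\<close>
      have "(\<lambda>_. 0, \<lambda>_. 0) \<in> ?D"
        by simp
      then have "?f (\<lambda>_. 0, \<lambda>_. 0) \<in> ?f ` ?D"
        by (rule imageI)
      then show "?f ` ?D \<noteq> {}"
        by (metis empty_iff)
      fix z assume "z \<in> ?f ` ?D"
      then show "z \<le> X / real N"
        by (elim imageE CollectE case_prodE) (simp only: prod.case box)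
    qed
    then show ?thesis
      using N1 by (simp add: X_def pos_le_divide_eq mult.commute)
  qed
  ultimately show ?thesis by blast
qed

end
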